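(* Consider the leader–follower multi-agent system run under the convergent-reference-state (CRS) algorithm described in the context. Assume: (1) the directed communication graph contains a directed spanning tree with the leader $n+1$ as root node; (2) the noise assumption in the context holds; (3) there exists a constant $x^*$ such that $\lim_{k\to\infty}x_{n+1}(k)=x^*$. If the coefficient $\beta$ in the estimation satisfies $$\beta>\frac{l_1}{f_B},\qquad l_1=\frac{h\lambda_W\lambda_L}{4\lambda_H\lambda_\phi d_*}+4\lambda_\phi^2\lambda_H^3d_*^2+d_*,$$ then, as $k\to\infty$, $$E\left(\hat x_{ij}(k)-x_j(k)\right)^2\to 0\quad\text{for } j\in\mathcal N_i,\ i=1,2,\dots,n+1,\ i\neq j,$$ and $$E\left(x_i(k)-x_{n+1}(k)\right)^2\to 0\quad\text{for all } i=1,\dots,n+1.$$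
   Context: Agents and graph. There are $n$ followers, labelled $1,\dots,n$, and one leader, labelled $n+1$; agent $i$ has state $x_i(k)\in\mathbb{R}$ at time $k$. The directed communication graph on $\{1,\dots,n+1\}$ has adjacency matrix $\mathcal A=(a_{ij})$, with $a_{ij}=1$ if there is an edge from $j$ to $i$ (then $j$ is a neighbor of $i$, written $j\in\mathcal N_i$) and $a_{ij}=0$ otherwise. The leader receives nothing from the followers: $a_{(n+1)j}=0$ for $j=1,\dots,n$. Let $d_i$ be the number of neighbors of agent $i$, $d_*=\max\{d_1,\dots,d_n\}$, and let $\mathcal L=\mathrm{diag}(d_1,\dots,d_{n+1})-\mathcal A$ be the Laplacian. Leader. The leader's state (the reference state) satisfies $x_{n+1}(k+1)=x_{n+1}(k)+f(k)$; $f(k)$ is its change rate. Binary observations and noise assumption. For $j\in\mathcal N_i$, agent $i$ receives from agent $j$ only $\mathcal S_{ij}(k)=1$ if $x_j(k)+\xi_{ij}(k)\le\mathcal B_{ij}$ and $\mathcal S_{ij}(k)=0$ otherwise, where $\mathcal B_{ij}$ is a fixed threshold. The noises $\xi_{ij}(k)$ are independent of the state of the system and follow a normal distribution with mean $0$, with distribution function $\mathcal F$ and density $\rho(x)=d\mathcal F(x)/dx\neq0$. CRS algorithm. Initial values $x_i(0)$ and $\hat x_{ij}(0)$ ($i=1,\dots,n$, $j\in\mathcal N_i$) are given with $|x_i(0)|\le\mathcal W$ and $|\hat x_{ij}(0)|\le\mathcal W$. With $\Pi_{\mathcal W}$ the projection of $\mathbb{R}$ onto $[-\mathcal W,\mathcal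 W]$, agent $i$ estimates its neighbors' states by $$\hat x_{ij}(k)=\Pi_{\mathcal W}\Big\{\hat x_{ij}(k-1)+\tfrac{\beta}{k}\big(\mathcal F(\mathcal B_{ij}-\hat x_{ij}(k-1))-\mathcal S_{ij}(k)\big)\Big\},$$ and the followers' states are updated by $$x_i(k+1)=x_i(k)-\tfrac{1}{k+1}\sum_{j=1}^{n+1}a_{ij}\,[x_i(k)-\hat x_{ij}(k)],\quad i=1,\dots,n.$$ Constants. Enumerate the pairs $(i,j)$, $i\in\{1,\dots,n\}$, $j\in\mathcal N_i$, by increasing $i$. $W$ is the $(d_1+\dots+d_n)\times(n+1)$ matrix whose row for the pair $(i,j)$ is $e_j^T$ ($e_j$ the $j$-th standard basis vector of $\mathbb{R}^{n+1}$). Let $\pi$ be the left eigenvector (row) of $\mathcal L$ for eigenvalue $0$ with $\pi 1_{n+1}=1$ ($1_{n+1}$ the all-ones column), and $J_{n+1}=1_{n+1}\pi$. Let $\Theta=[q,\psi]$ be an orthogonal matrix, $\psi$ of size $(n+1)\times n$ with $\mathrm{rank}\,\psi=\mathrm{rank}\,\mathcal L$, with $\Theta^{-1}=\begin{pmatrix}\tau\\ \phi\end{pmatrix}$, $\phi$ of size $n\times(n+1)$, such that $\Theta^{-1}\mathcal L\Theta=\begin{pmatrix}0&0\\0&\tilde{\mathcal L}\end{pmatrix}$, where $\tilde{\mathcal L}$ is a Jordan matrix whose eigenvalues are the nonzero eigenvalues of $\mathcal L$, with positive real parts. Given any positive number $\kappa$, $H$ is a symmetric positive definite matrix with $H\tilde{\mathcal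 L}+\tilde{\mathcal L}^TH=\kappa I$. Set $\lambda_H=\lambda_{\max}(H)$, $h=1/\lambda_{\min}(H)$, $\lambda_\phi=\lambda_{\max}\big((I-J_{n+1})^T\phi^TH\phi(I-J_{n+1})\big)$, $\lambda_W=\lambda_{\max}(WW^T)$, $\lambda_L=\lambda_{\max}(\mathcal L\mathcal L^T)$, $f_B=\rho(B+\mathcal W)$ with $B=\max_{j\in\mathcal N_i,\,i=1,\dots,n}|\mathcal B_{ij}|$.
   Formalization: Adds |x*| ≤ W (otherwise the claim fails, since the estimates stay in [-W, W]); Θ is only required to be invertible, since an orthogonal Θ with the stated block form cannot exist; matrices may be complex, with the adjoint in place of the transpose for Θ and H. *)

theory Defs
  imports
    "HOL-Probability.Probability"
    "Jordan_Normal_Form.Jordan_Normal_Form"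
    "Jordan_Normal_Form.Schur_Decomposition"
    "Jordan_Normal_Form.DL_Rank"
begin

(* Agents are numbered from 0 to match the matrix indices of Jordan_Normal_Form: the
   followers are 0, ..., n - 1 and the leader is n.  A pair (j, i) in E is an edge from j to i,
   so that i receives information from j. *)

definition nbrs :: "(nat \<times> nat) set \<Rightarrow> nat \<Rightarrow> nat set" where
  "nbrs E i = {j. (j, i) \<in> E}"

definition adj :: "(nat \<times> nat) set \<Rightarrow> nat \<Rightarrow> nat \<Rightarrow> real" where
  "adj E i j = (if j \<in> nbrs E i then 1 else 0)"

definition deg :: "(nat \<times> nat) set \<Rightarrow> nat \<Rightarrow> nat" where
  "deg E i = card (nbrs E i)"

definition max_deg :: "nat \<Rightarrow> (nat \<times> nat) set \<Rightarrow> nat" where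
  "max_deg n E = Max (deg E ` {..<n})"

definition directed_spanning_tree ::
    "'v set \<Rightarrow> ('v \<times> 'v) set \<Rightarrow> 'v \<Rightarrow> ('v \<times> 'v) set \<Rightarrow> bool" where
  "directed_spanning_tree V E r T \<longleftrightarrow>
     T \<subseteq> E \<and> T \<subseteq> V \<times> V \<and> r \<in> V \<and>
     (\<nexists>u. (u, r) \<in> T) \<and>
     (\<forall>v\<in>V - {r}. \<exists>!u. (u, v) \<in> T) \<and>
     (\<forall>v\<in>V. (r, v) \<in> T\<^sup>*)"

(* All matrices are complex, because the Jordan form of the Laplacian of a directed graph need
   not be real. *)

definition laplacian :: "nat \<Rightarrow> (nat \<times> nat) set \<Rightarrow> complex mat" where
  "laplacian n E =
     mat_diag (n + 1) (\<lambda>i. of_nat (deg E i)) -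
     mat (n + 1) (n + 1) (\<lambda>(i, j). complex_of_real (adj E i j))"

definition follower_pairs :: "nat \<Rightarrow> (nat \<times> nat) set \<Rightarrow> (nat \<times> nat) list" where
  "follower_pairs n E =
     concat (map (\<lambda>i. map (\<lambda>j. (i, j)) (filter (\<lambda>j. j \<in> nbrs E i) [0..<n + 1])) [0..<n])"

definition selection_mat :: "nat \<Rightarrow> (nat \<times> nat) set \<Rightarrow> complex mat" where
  "selection_mat n E =
     mat_of_rows (n + 1) (map (\<lambda>(i, j). unit_vec (n + 1) j) (follower_pairs n E))"

definition ones_times_row :: "nat \<Rightarrow> complex vec \<Rightarrow> complex mat" where
  "ones_times_row m p = mat m m (\<lambda>(i, j). vec_index p j)"

(* Extreme eigenvalues; used for Hermitian matrices only, whose eigenvalues are all real. *)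

definition lambda_max :: "complex mat \<Rightarrow> real" where
  "lambda_max A = Max {r. eigenvalue A (complex_of_real r)}"

definition lambda_min :: "complex mat \<Rightarrow> real" where
  "lambda_min A = Min {r. eigenvalue A (complex_of_real r)}"

definition hermitian_pos_def :: "nat \<Rightarrow> complex mat \<Rightarrow> bool" where
  "hermitian_pos_def m H \<longleftrightarrow>
     H \<in> carrier_mat m m \<and> mat_adjoint H = H \<and>
     (\<forall>v\<in>carrier_vec m. v \<noteq> 0\<^sub>v m \<longrightarrow> 0 < Re ((H *\<^sub>v v) \<bullet>c v))"

(* [q, psi] *)
definition append_cols :: "complex mat \<Rightarrow> complex mat \<Rightarrow> complex mat" where
  "append_cols q \<psi> =
     four_block_mat q \<psi> (0\<^sub>m 0 (dim_col q)) (0\<^sub>m 0 (dim_col \<psi>))"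

(* For a directed graph with a leader the transformation Theta can be invertible but not
   orthogonal (nor unitary): orthogonality would make the all-ones vector a left null vector of
   the Laplacian, whose left null space is spanned by the unit vector of the leader.  Hence
   only the existence of the inverse (tau; phi) is required. *)

definition laplacian_decomposition ::
    "nat \<Rightarrow> complex mat \<Rightarrow> complex mat \<Rightarrow> complex mat \<Rightarrow> complex mat \<Rightarrow> complex mat
      \<Rightarrow> complex mat \<Rightarrow> bool" where
  "laplacian_decomposition n L q \<psi> \<tau> \<phi> Lt \<longleftrightarrow>
     q \<in> carrier_mat (n + 1) 1 \<and> \<psi> \<in> carrier_mat (n + 1) n \<and>
     \<tau> \<in> carrier_mat 1 (n + 1) \<and> \<phi> \<in> carrier_mat n (n + 1) \<and>
     Lt \<in> carrier_mat n n \<and>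
     inverts_mat (append_cols q \<psi>) (\<tau> @\<^sub>r \<phi>) \<and>
     inverts_mat (\<tau> @\<^sub>r \<phi>) (append_cols q \<psi>) \<and>
     vec_space.rank (n + 1) \<psi> = vec_space.rank (n + 1) L \<and>
     (\<tau> @\<^sub>r \<phi>) * L * append_cols q \<psi> =
       four_block_mat (0\<^sub>m 1 1) (0\<^sub>m 1 n) (0\<^sub>m n 1) Lt \<and>
     (\<exists>blocks. Lt = jordan_matrix blocks) \<and>
     {e. eigenvalue Lt e} = {e. eigenvalue L e \<and> e \<noteq> 0} \<and>
     (\<forall>e. eigenvalue Lt e \<longrightarrow> 0 < Re e)"

definition lambda_phi :: "nat \<Rightarrow> complex mat \<Rightarrow> complex mat \<Rightarrow> complex vec \<Rightarrow> real" where
  "lambda_phi n H \<phi> p =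
     (let P = 1\<^sub>m (n + 1) - ones_times_row (n + 1) p
      in lambda_max (mat_adjoint P * mat_adjoint \<phi> * H * \<phi> * P))"

definition crs_l1 ::
    "nat \<Rightarrow> (nat \<times> nat) set \<Rightarrow> complex mat \<Rightarrow> complex mat \<Rightarrow> complex vec \<Rightarrow> real" where
  "crs_l1 n E H \<phi> p =
     (let L = laplacian n E;
          W = selection_mat n E;
          d = real (max_deg n E);
          h = 1 / lambda_min H;
          lH = lambda_max H;
          lphi = lambda_phi n H \<phi> p;
          lW = lambda_max (W * transpose_mat W);
          lL = lambda_max (L * transpose_mat L)
      in h * lW * lL / (4 * lH * lphi * d) + 4 * lphi^2 * lH^3 * d^2 + d)"

definition max_threshold :: "nat \<Rightarrow> (nat \<times> nat) set \<Rightarrow> (nat \<Rightarrow> nat \<Rightarrow> real) \<Rightarrow> real" where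
  "max_threshold n E b = Max {\<bar>b i j\<bar> | i j. i < n \<and> j \<in> nbrs E i}"

definition normal_cdf :: "real \<Rightarrow> real \<Rightarrow> real" where
  "normal_cdf \<sigma> = cdf (density lborel (normal_density 0 \<sigma>))"

definition binary_obs :: "real \<Rightarrow> real \<Rightarrow> real" where
  "binary_obs c y = (if y \<le> c then 1 else 0)"

(* The events determined by the state of the system before the noise at time k acts: the
   agents' states up to time k and the estimates up to time k - 1 (the estimates at time k
   already depend on that noise). *)

definition past_events ::
    "'w measure \<Rightarrow> nat \<Rightarrow> (nat \<times> nat) set \<Rightarrow> (nat \<Rightarrow> nat \<Rightarrow> 'w \<Rightarrow> real)
      \<Rightarrow> (nat \<Rightarrow> nat \<Rightarrow> nat \<Rightarrow> 'w \<Rightarrow> real) \<Rightarrow> nat \<Rightarrow> 'w set set" where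
  "past_events M n E x xh k =
     sigma_sets (space M)
       ({x i s -` A \<inter> space M | i s A. i \<le> n \<and> s \<le> k \<and> A \<in> sets borel} \<union>
        {xh i j s -` A \<inter> space M | i j s A. i < n \<and> j \<in> nbrs E i \<and> s < k \<and> A \<in> sets borel})"

end

(* All extreme eigenvalues in l_1 belong to positive semidefinite matrices, so l_1 is nonnegative
   and the gain condition gives beta > 0.

   The centred observation noise of each link consists of bounded orthogonal increments, so its
   averages tend to 0 almost surely.  On a path with this property, writing F(b - xh) - F(b - x) as
   -g (xh - x) with g between two positive constants makes the algorithm a relaxation: every
   estimate moves with weight of order 1/k towards the state it estimates, and every state towards
   the mean of its estimates.  Hence the limsup of the deviation of a follower from xstar is at most
   the mean of those of its neighbours, while that of the leader is 0.  The maximum principle along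
   the spanning tree makes all of them 0, and boundedness gives mean-square convergence. *)

theory Submission
  imports Defs "Jordan_Normal_Form.Spectral_Radius" "HOL-Library.Discrete_Functions"
    "HOL-Real_Asymp.Real_Asymp"
begin

section \<open>Nonnegativity of the gain bound\<close>

text \<open>The delicate point is the orthogonality. Independence of a noise variable is available
  only from \<open>past_events\<close>, which is generated by states and earlier estimates but not
  by earlier noises, whereas an earlier centred noise contains an observation and hence a noise. The
  earlier observations are therefore reconstructed from pairs of consecutive estimates, which brings
  them into the past. For \<open>\<W> = 0\<close> the projection erases this information; but it
  then erases the noise as well, so the increments \<open>m\<close> are set to 0 in that case.

  The gain \<beta>/k is what turns the accumulated noise into plain averages: up to a remainder that
  the relaxation absorbs, the noise part of an estimate is \<beta> times the mean of the increments.
  The divergence of the harmonic series makes a relaxation with weights of order 1/k forget its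
  initial value, so the limsups can be compared without any loss in the constants. This exactness
  matters, because the maximum principle has no room for a factor greater than 1.\<close>

lemma mat_adjoint_adjunction:
  fixes A :: "complex mat"
  assumes "A \<in> carrier_mat m k" "v \<in> carrier_vec k" "w \<in> carrier_vec m"
  shows "(mat_adjoint A *\<^sub>v w) \<bullet>c v = w \<bullet>c (A *\<^sub>v v)"
proof -
  have "(mat_adjoint A *\<^sub>v w) \<bullet>c v = (\<Sum>i<k. \<Sum>j<m. cnj (A $$ (j, i)) * vec_index w j * cnj (vec_index v i))"
    using assms by (auto simp: mat_adjoint_def mat_of_rows_def scalar_prod_def sum_distrib_right atLeast0LessThan
        intro!: sum.cong)
  also have "\<dots> = (\<Sum>j<m. \<Sum>i<k. cnj (A $$ (j, i)) * vec_index w j * cnj (vec_index v i))"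
    by (rule sum.swap)
  also have "\<dots> = w \<bullet>c (A *\<^sub>v v)"
    using assms by (auto simp: scalar_prod_def sum_distrib_left atLeast0LessThan mult_ac cnj_sum
        intro!: sum.cong)
  finally show ?thesis .
qed

lemma mat_adjoint_carrier:
  "A \<in> carrier_mat m k \<Longrightarrow> mat_adjoint A \<in> carrier_mat k m"
  by (auto simp: mat_adjoint_def)

lemma complex_nonneg_iff: "0 \<le> (z::complex) \<longleftrightarrow> 0 \<le> Re z \<and> Im z = 0"
  by (auto simp: less_eq_complex_def)

text \<open>The order on the complex numbers includes reality, so both the hypothesis and the
  conclusion say "real and nonnegative".\<close>

lemma psd_eigenvalue:
  fixes A :: "complex mat"
  assumes A: "A \<in> carrier_mat m m"
    and psd: "\<And>v. v \<in> carrier_vec m \<Longrightarrow> 0 \<le> (A *\<^sub>v v) \<bullet>c v"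
    and e: "eigenvalue A e"
  shows "0 \<le> e"
proof -
  obtain v where v: "v \<in> carrier_vec m" "v \<noteq> 0\<^sub>v m" "A *\<^sub>v v = e \<cdot>\<^sub>v v"
    using e A by (auto simp: eigenvalue_def eigenvector_def)
  have "0 < v \<bullet>c v"
    using v(1,2) by simp
  then have pos: "0 < Re (v \<bullet>c v)" "Im (v \<bullet>c v) = 0"
    by (auto simp: less_complex_def)
  have "0 \<le> e * (v \<bullet>c v)"
    using psd[OF v(1)] v by simp
  with pos show ?thesis
    by (auto simp: complex_nonneg_iff zero_le_mult_iff)
qed

text \<open>\<open>lambda_max\<close> and \<open>lambda_min\<close> look at real eigenvalues only.
  Semidefiniteness makes the whole spectrum real, so for positive dimension the set is finite and
  nonempty and \<open>Max\<close> and \<open>Min\<close> pick genuine eigenvalues.\<close>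

lemma psd_lambda_nonneg:
  fixes A :: "complex mat"
  assumes A: "A \<in> carrier_mat m m" and m: "0 < m"
    and psd: "\<And>v. v \<in> carrier_vec m \<Longrightarrow> 0 \<le> (A *\<^sub>v v) \<bullet>c v"
  shows "0 \<le> lambda_max A" "0 \<le> lambda_min A"
proof -
  let ?S = "{r. eigenvalue A (complex_of_real r)}"
  have "finite {e. eigenvalue A e}"
    using card_finite_spectrum(1)[OF A] by (simp add: spectrum_def)
  then have fin: "finite ?S"
    using finite_vimageI[of "{e. eigenvalue A e}" complex_of_real] by (simp add: vimage_def inj_def)
  obtain e where "eigenvalue A e"
    using spectrum_non_empty[OF A m] by (auto simp: spectrum_def)
  moreover from psd_eigenvalue[OF A psd this] have "e = complex_of_real (Re e)"
    by (simp add: complex_nonneg_iff complex_eq_iff)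
  ultimately have ne: "?S \<noteq> {}"
    by (metis Collect_empty_eq)
  have "0 \<le> r" if "r \<in> ?S" for r
    using psd_eigenvalue[OF A psd, of "complex_of_real r"] that by (simp add: complex_nonneg_iff)
  then show "0 \<le> lambda_max A" "0 \<le> lambda_min A"
    using Max_in[OF fin ne] Min_in[OF fin ne] unfolding lambda_max_def lambda_min_def by blast+
qed

text \<open>The gain bound is written with transposes; the hypothesis \<open>real\<close> expresses
  that the entries are real, and then the quadratic form at v is the squared norm of the transpose
  applied to v.\<close>

lemma gram_lambda_max_nonneg:
  assumes B: "B \<in> carrier_mat m k" and m: "0 < m" and real: "transpose_mat B = mat_adjoint B"
  shows "0 \<le> lambda_max (B * transpose_mat B)"
proof (rule psd_lambda_nonneg)
  let ?C = "transpose_mat B"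
  have C: "?C \<in> carrier_mat k m" using B by simp
  show "B * ?C \<in> carrier_mat m m" using B by simp
  fix v :: "complex vec" assume v: "v \<in> carrier_vec m"
  have adj: "B = mat_adjoint ?C"
  proof (rule eq_matI)
    fix i j assume "i < dim_row (mat_adjoint ?C)" "j < dim_col (mat_adjoint ?C)"
    then have ij: "i < m" "j < k" using B by (auto simp: mat_adjoint_def)
    have "mat_adjoint ?C $$ (i, j) = cnj (?C $$ (j, i))"
      using ij B by (simp add: mat_adjoint_def mat_of_rows_def)
    also have "\<dots> = cnj (mat_adjoint B $$ (j, i))"
      using real by simp
    also have "\<dots> = B $$ (i, j)"
      using ij B by (simp add: mat_adjoint_def mat_of_rows_def)
    finally show "B $$ (i, j) = mat_adjoint ?C $$ (i, j)" by simp
  qed (use B in \<open>auto simp: mat_adjoint_def\<close>)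
  have Cv: "?C *\<^sub>v v \<in> carrier_vec k" using C v by simp
  have "((B * ?C) *\<^sub>v v) \<bullet>c v = (mat_adjoint ?C *\<^sub>v (?C *\<^sub>v v)) \<bullet>c v"
    using B C v adj by (metis assoc_mult_mat_vec)
  also have "\<dots> = (?C *\<^sub>v v) \<bullet>c (?C *\<^sub>v v)"
    by (rule mat_adjoint_adjunction[OF C v Cv])
  finally show "0 \<le> ((B * ?C) *\<^sub>v v) \<bullet>c v"
    by (simp add: conjugate_square_ge_0_vec)
qed (rule m)

lemma cscalar_prod_commute:
  fixes u v :: "complex vec"
  assumes "u \<in> carrier_vec m" "v \<in> carrier_vec m"
  shows "u \<bullet>c v = cnj (v \<bullet>c u)"
  using assms by (auto simp: scalar_prod_def mult_ac cnj_sum intro!: sum.cong)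

text \<open>The definition controls only the real part of the form; its imaginary part vanishes
  because H is self-adjoint.\<close>

lemma hermitian_pos_def_nonneg:
  assumes H: "hermitian_pos_def m H" and v: "v \<in> carrier_vec m"
  shows "0 \<le> (H *\<^sub>v v) \<bullet>c v"
proof -
  have Hc: "H \<in> carrier_mat m m" "mat_adjoint H = H"
    using H by (auto simp: hermitian_pos_def_def)
  have Hv: "H *\<^sub>v v \<in> carrier_vec m" using Hc v by simp
  have "(H *\<^sub>v v) \<bullet>c v = v \<bullet>c (H *\<^sub>v v)"
    using mat_adjoint_adjunction[OF Hc(1) v v] Hc(2) by simp
  also have "\<dots> = cnj ((H *\<^sub>v v) \<bullet>c v)"
    by (rule cscalar_prod_commute[OF v Hv])
  finally have "Im ((H *\<^sub>v v) \<bullet>c v) = 0"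
    by (metis Im_complex_of_real complex_cnj_cancel_iff Reals_cnj_iff complex_is_Real_iff)
  moreover have "0 \<le> Re ((H *\<^sub>v v) \<bullet>c v)"
  proof (cases "v = 0\<^sub>v m")
    case True
    then show ?thesis using Hv by simp
  next
    case False
    then show ?thesis using H v by (auto simp: hermitian_pos_def_def less_imp_le)
  qed
  ultimately show ?thesis by (simp add: complex_nonneg_iff)
qed

text \<open>Moving the two adjoints across the inner product turns the quadratic form at v into that
  of H at \<open>\<phi> *\<^sub>v (P *\<^sub>v v)\<close>.\<close>

lemma lambda_phi_nonneg:
  assumes H: "hermitian_pos_def n H" and \<phi>: "\<phi> \<in> carrier_mat n (n + 1)"
  shows "0 \<le> lambda_phi n H \<phi> p"
proof -
  define P where "P = 1\<^sub>m (n + 1) - ones_times_row (n + 1) p"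
  have P: "P \<in> carrier_mat (n + 1) (n + 1)"
    unfolding P_def ones_times_row_def by (rule minus_carrier_mat) simp
  have Hc: "H \<in> carrier_mat n n"
    using H by (auto simp: hermitian_pos_def_def)
  note Pa = mat_adjoint_carrier[OF P] and \<phi>a = mat_adjoint_carrier[OF \<phi>]
  note c1 = mult_carrier_mat[OF Pa \<phi>a]
  note c2 = mult_carrier_mat[OF c1 Hc]
  note c3 = mult_carrier_mat[OF c2 \<phi>]
  have "0 \<le> lambda_max (mat_adjoint P * mat_adjoint \<phi> * H * \<phi> * P)"
  proof (rule psd_lambda_nonneg)
    show "mat_adjoint P * mat_adjoint \<phi> * H * \<phi> * P \<in> carrier_mat (n + 1) (n + 1)"
      by (rule mult_carrier_mat[OF c3 P])
    fix v :: "complex vec" assume v: "v \<in> carrier_vec (n + 1)"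
    let ?w = "\<phi> *\<^sub>v (P *\<^sub>v v)"
    have Pv: "P *\<^sub>v v \<in> carrier_vec (n + 1)" and w: "?w \<in> carrier_vec n"
      using P v \<phi> by auto
    have Hw: "H *\<^sub>v ?w \<in> carrier_vec n" using Hc w by simp
    have "((mat_adjoint P * mat_adjoint \<phi> * H * \<phi> * P) *\<^sub>v v)
        = mat_adjoint P *\<^sub>v (mat_adjoint \<phi> *\<^sub>v (H *\<^sub>v ?w))"
      by (simp only: assoc_mult_mat_vec[OF c3 P v] assoc_mult_mat_vec[OF c2 \<phi> Pv]
          assoc_mult_mat_vec[OF c1 Hc w] assoc_mult_mat_vec[OF Pa \<phi>a Hw])
    also have "\<dots> \<bullet>c v = (mat_adjoint \<phi> *\<^sub>v (H *\<^sub>v ?w)) \<bullet>c (P *\<^sub>v v)"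
      using \<phi>a Hw by (intro mat_adjoint_adjunction[OF P v]) simp
    also have "\<dots> = (H *\<^sub>v ?w) \<bullet>c ?w"
      by (rule mat_adjoint_adjunction[OF \<phi> Pv Hw])
    finally show "0 \<le> ((mat_adjoint P * mat_adjoint \<phi> * H * \<phi> * P) *\<^sub>v v) \<bullet>c v"
      using hermitian_pos_def_nonneg[OF H w] by simp
  qed simp
  then show ?thesis by (simp add: lambda_phi_def P_def Let_def)
qed

text \<open>The selection matrix has one row per follower pair, so \<open>pairs\<close> guarantees
  that its Gram matrix has an eigenvalue at all. Nonnegativity of the ingredients suffices even
  where a denominator vanishes, as division by 0 yields 0.\<close>

lemma crs_l1_nonneg:
  assumes H: "hermitian_pos_def n H" and n: "0 < n" and \<phi>: "\<phi> \<in> carrier_mat n (n + 1)"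
    and pairs: "follower_pairs n E \<noteq> []"
  shows "0 \<le> crs_l1 n E H \<phi> p"
proof -
  have Hc: "H \<in> carrier_mat n n"
    using H by (auto simp: hermitian_pos_def_def)
  note lam = psd_lambda_nonneg[OF Hc n hermitian_pos_def_nonneg[OF H]]
  have L: "laplacian n E \<in> carrier_mat (n + 1) (n + 1)"
    unfolding laplacian_def by (rule minus_carrier_mat) simp
  have lL: "0 \<le> lambda_max (laplacian n E * transpose_mat (laplacian n E))"
  proof (rule gram_lambda_max_nonneg[OF L])
    show "transpose_mat (laplacian n E) = mat_adjoint (laplacian n E)"
      using L by (intro eq_matI)
        (auto simp: mat_adjoint_def mat_of_rows_def laplacian_def mat_diag_def)
  qed simp
  let ?l = "length (follower_pairs n E)"
  have W: "selection_mat n E \<in> carrier_mat ?l (n + 1)"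
    unfolding selection_mat_def by (rule carrier_matI) simp_all
  have lW: "0 \<le> lambda_max (selection_mat n E * transpose_mat (selection_mat n E))"
  proof (rule gram_lambda_max_nonneg[OF W])
    show "0 < ?l" using pairs by simp
    have jn: "j < n + 1" if "(i, j) \<in> set (follower_pairs n E)" for i j
      using that by (auto simp: follower_pairs_def simp del: upt_Suc)
    show "transpose_mat (selection_mat n E) = mat_adjoint (selection_mat n E)"
    proof (rule eq_matI)
      fix a c assume "a < dim_row (mat_adjoint (selection_mat n E))"
        "c < dim_col (mat_adjoint (selection_mat n E))"
      then have ac: "a < n + 1" "c < ?l" using W by (auto simp: mat_adjoint_def)
      obtain i j where ij: "follower_pairs n E ! c = (i, j)" by force
      then have "j < n + 1" using jn[of i j] ac(2) nth_mem by metis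
      then show "transpose_mat (selection_mat n E) $$ (a, c) =
          mat_adjoint (selection_mat n E) $$ (a, c)"
        using ac ij by (simp add: selection_mat_def mat_adjoint_def mat_of_rows_def unit_vec_def)
    qed (use W in \<open>auto simp: mat_adjoint_def\<close>)
  qed
  show ?thesis
    unfolding crs_l1_def Let_def
    using lam lL lW lambda_phi_nonneg[OF H \<phi>, of p] by (intro add_nonneg_nonneg) auto
qed

section \<open>Recursions with weights of order 1/k\<close>

section \<open>Pathwise convergence\<close>

text \<open>Since 1 - x \<le> exp (- x), the product of the factors is at most the exponential of -c
  times a harmonic partial sum, and the harmonic series diverges.\<close>

lemma contraction_tendsto_zero:
  fixes w :: "nat \<Rightarrow> real"
  assumes c: "0 < c" and nonneg: "\<And>k. 0 \<le> w k"
    and step: "\<And>k. K \<le> k \<Longrightarrow> w (Suc k) \<le> (1 - c / real (k + 1)) * w k"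
  shows "w \<longlonglongrightarrow> 0"
proof -
  have bound: "w k \<le> w K * exp (c * harm K) * exp (- (c * harm k))" if "K \<le> k" for k
    using that
  proof (induction k rule: dec_induct)
    case base
    have "w K = w K * exp (c * harm K) * exp (- (c * harm K))"
      by (simp add: mult.assoc flip: exp_add)
    then show ?case by (rule eq_refl)
  next
    case (step k)
    have "w (Suc k) \<le> (1 - c / real (k + 1)) * w k"
      using assms(3) step by simp
    \<comment> \<open>The exponential replaces the factor before the induction hypothesis is
      applied, because the factor itself may be negative for small k.\<close>
    also have "\<dots> \<le> exp (- (c / real (k + 1))) * w k"
      using exp_ge_add_one_self[of "- (c / real (k + 1))"] nonneg by (intro mult_right_mono) auto
    also have "\<dots> \<le> exp (- (c / real (k + 1))) * (w K * exp (c * harm K) * exp (- (c * harm k)))"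
      using step by (intro mult_left_mono) auto
    also have "\<dots> = w K * exp (c * harm K) * exp (- (c * harm (Suc k)))"
      by (simp add: harm_Suc exp_add[symmetric] algebra_simps divide_inverse)
    finally show ?case .
  qed
  have "filterlim (\<lambda>k. c * harm k :: real) at_top sequentially"
    using harm_at_top c by (rule filterlim_tendsto_pos_mult_at_top[OF tendsto_const, rotated])
  then have "(\<lambda>k. exp (- (c * harm k)) :: real) \<longlonglongrightarrow> 0"
    by (intro filterlim_compose[OF exp_at_bot]) (simp add: filterlim_uminus_at_bot)
  then have "(\<lambda>k. w K * exp (c * harm K) * exp (- (c * harm k))) \<longlonglongrightarrow> 0"
    by (rule tendsto_mult_right_zero)
  then show ?thesis
    using tendsto_sandwich[OF _ eventually_sequentiallyI[OF bound] tendsto_const] nonneg by simp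
qed

text \<open>Only the excess of u above a is followed: targets below a cannot raise it, so it
  contracts by 1 - \<gamma>. The alternative s allows moves outside the relaxation, which are
  harmless when they end below a.\<close>

lemma relaxation_eventually_le:
  fixes u t s \<gamma> :: "nat \<Rightarrow> real"
  assumes c: "0 < c" and \<epsilon>: "0 < \<epsilon>"
    and \<gamma>: "\<forall>\<^sub>F k in sequentially. c / real (k + 1) \<le> \<gamma> k \<and> \<gamma> k \<le> 1"
    and u: "\<forall>\<^sub>F k in sequentially. u (Suc k) \<le> max ((1 - \<gamma> k) * u k + \<gamma> k * t k) (s k)"
    and t: "\<forall>\<^sub>F k in sequentially. t k \<le> a"
    and s: "\<forall>\<^sub>F k in sequentially. s k \<le> a"
  shows "\<forall>\<^sub>F k in sequentially. u k \<le> a + \<epsilon>"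
proof -
  define w where "w k = max 0 (u k - a)" for k
  have "\<forall>\<^sub>F k in sequentially. w (Suc k) \<le> (1 - c / real (k + 1)) * w k"
    using \<gamma> u t s
  proof eventually_elim
    case (elim k)
    have nn: "0 \<le> w k" and uw: "u k \<le> a + w k" by (auto simp: w_def)
    have pos: "0 \<le> \<gamma> k" using elim(1) c by (smt (verit) divide_nonneg_nonneg of_nat_0_le_iff)
    have "(1 - \<gamma> k) * u k + \<gamma> k * t k \<le> (1 - \<gamma> k) * (a + w k) + \<gamma> k * a"
      using elim uw pos by (intro add_mono mult_left_mono) auto
    also have "\<dots> = a + (1 - \<gamma> k) * w k" by (simp add: algebra_simps)
    finally have "u (Suc k) - a \<le> max ((1 - \<gamma> k) * w k) 0"
      using elim(2,4) by linarith
    then have "w (Suc k) \<le> (1 - \<gamma> k) * w k"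
      using elim(1) nn by (simp add: w_def[of "Suc k"] max_def split: if_splits)
    also have "\<dots> \<le> (1 - c / real (k + 1)) * w k"
      using elim(1) nn by (intro mult_right_mono) auto
    finally show ?case .
  qed
  then obtain K where "\<And>k. K \<le> k \<Longrightarrow> w (Suc k) \<le> (1 - c / real (k + 1)) * w k"
    by (auto simp: eventually_sequentially)
  then have "w \<longlonglongrightarrow> 0"
    by (intro contraction_tendsto_zero[OF c]) (auto simp: w_def)
  then have "\<forall>\<^sub>F k in sequentially. w k < \<epsilon>"
    using \<epsilon> by (rule order_tendstoD)
  then show ?thesis
    by eventually_elim (auto simp: w_def)
qed

lemma closest_point_interval:
  fixes z W :: real
  assumes "0 \<le> W"
  shows "closest_point {- W..W} z = max (- W) (min W z)"
  by (rule closest_point_unique[symmetric]) (use assms in \<open>auto simp: dist_real_def\<close>)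

text \<open>Subtracting the averaged noise \<open>N\<close> turns the recursion into a noise-free relaxation towards
  \<open>y\<close>.  The projection can increase \<open>\<bar>xh - N - xs\<bar>\<close> only up to \<open>\<bar>N\<bar>\<close>, because \<open>xs\<close> lies in the
  interval; this accounts for the term \<open>s\<close> of the relaxation lemma.\<close>
lemma projected_tracking:
  fixes xh y m g :: "nat \<Rightarrow> real"
  assumes c: "0 < c" and g: "\<And>k. c \<le> g k" "\<And>k. g k \<le> C"
    and xs: "\<bar>xs\<bar> \<le> W"
    and rec: "\<And>k. xh (Suc k) = closest_point {- W..W}
        (xh k - g k / real (k + 1) * (xh k - y (Suc k)) + \<beta> / real (k + 1) * m (Suc k))"
    and noise: "(\<lambda>k. (\<Sum>l=1..k. m l) / real k) \<longlonglongrightarrow> 0"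
    and y: "\<And>\<epsilon>. 0 < \<epsilon> \<Longrightarrow> \<forall>\<^sub>F k in sequentially. \<bar>y k - xs\<bar> \<le> a + \<epsilon>"
    and a: "0 \<le> a" and \<epsilon>: "0 < \<epsilon>"
  shows "\<forall>\<^sub>F k in sequentially. \<bar>xh k - xs\<bar> \<le> a + \<epsilon>"
proof -
  define N where "N k = \<beta> * ((\<Sum>l=1..k. m l) / real k)" for k
  have "N \<longlonglongrightarrow> 0"
    unfolding N_def by (rule tendsto_mult_right_zero[OF noise])
  then have N0: "\<forall>\<^sub>F k in sequentially. \<bar>N k\<bar> \<le> e" if "0 < e" for e
    using that by (auto dest!: tendstoD[where e = e] elim: eventually_mono)
  have NS: "N j * real j = \<beta> * (\<Sum>l=1..j. m l)" for j
    by (simp add: N_def)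
  \<comment> \<open>The running mean is itself a relaxation with weight 1/(k+1). The noise term is
    thus an increment of N, which the substitution removes, plus a remainder of the same order as
    the relaxation step.\<close>
  have Nrec: "\<beta> / real (k + 1) * m (Suc k) = N (Suc k) - N k + N k / real (k + 1)" for k
  proof -
    have "N (Suc k) * real (k + 1) = N k * real k + \<beta> * m (Suc k)"
      using NS[of k] NS[of "Suc k"] by (simp add: distrib_left)
    then have "\<beta> / real (k + 1) * m (Suc k) = N (Suc k) - N k * (real k / real (k + 1))"
      by (simp add: field_simps)
    also have "real k / real (k + 1) = 1 - 1 / real (k + 1)"
      by (simp add: field_simps)
    finally show ?thesis by (simp add: right_diff_distrib)
  qed
  \<comment> \<open>The remainder enters with weight (1 - g)/(k+1). As g \<ge> c, its modulus is at
    most g (1 + 1/c)/(k+1), so it can be charged to the target; this is the origin of 1 + 1/c in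
    t.\<close>
  define u \<gamma> t where "u k = \<bar>xh k - N k - xs\<bar>" and "\<gamma> k = g k / real (k + 1)"
    and "t k = \<bar>y (Suc k) - xs\<bar> + \<bar>N k\<bar> * (1 + 1 / c)" for k
  have step: "u (Suc k) \<le> max ((1 - \<gamma> k) * u k + \<gamma> k * t k) \<bar>N (Suc k)\<bar>" if "\<gamma> k \<le> 1" for k
  proof -
    define z where "z = xh k - \<gamma> k * (xh k - y (Suc k)) + (N (Suc k) - N k + N k / real (k + 1))"
    have "0 \<le> \<gamma> k" using g(1)[of k] c by (simp add: \<gamma>_def)
    have "z - N (Suc k) - xs = (1 - \<gamma> k) * (xh k - N k - xs) + \<gamma> k * (y (Suc k) - xs)
        + (1 - g k) * (N k / real (k + 1))"
      by (simp add: z_def \<gamma>_def divide_inverse algebra_simps)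
    also have "\<bar>\<dots>\<bar> \<le> (1 - \<gamma> k) * u k + \<gamma> k * \<bar>y (Suc k) - xs\<bar> + \<bar>1 - g k\<bar> * (\<bar>N k\<bar> / real (k + 1))"
      using that \<open>0 \<le> \<gamma> k\<close> unfolding u_def
      by (intro order_trans[OF abs_triangle_ineq] add_mono) (simp_all add: abs_mult)
    also have "\<bar>1 - g k\<bar> \<le> g k * (1 + 1 / c)"
    proof -
      have "1 \<le> g k * (1 / c)" "0 \<le> g k" using g(1)[of k] c by simp_all
      then show ?thesis by (simp add: distrib_left)
    qed
    then have "\<bar>1 - g k\<bar> * (\<bar>N k\<bar> / real (k + 1)) \<le> g k * (1 + 1 / c) * (\<bar>N k\<bar> / real (k + 1))"
      by (rule mult_right_mono) simp
    also have "g k * (1 + 1 / c) * (\<bar>N k\<bar> / real (k + 1)) = \<gamma> k * (\<bar>N k\<bar> * (1 + 1 / c))"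
      by (simp add: \<gamma>_def)
    finally have z: "\<bar>z - N (Suc k) - xs\<bar> \<le> (1 - \<gamma> k) * u k + \<gamma> k * t k"
      by (simp add: t_def distrib_left)
    have "xh (Suc k) = max (- W) (min W z)"
      using xs rec[of k] unfolding Nrec by (simp add: z_def \<gamma>_def closest_point_interval)
    then have "u (Suc k) \<le> max \<bar>z - N (Suc k) - xs\<bar> \<bar>N (Suc k)\<bar>"
      using xs unfolding u_def by linarith
    with z show ?thesis by linarith
  qed
  have "(\<lambda>k. C / real (k + 1)) \<longlonglongrightarrow> 0"
    by real_asymp
  then have "\<forall>\<^sub>F k in sequentially. C / real (k + 1) < 1"
    by (rule order_tendstoD) simp
  then have \<gamma>: "\<forall>\<^sub>F k in sequentially. c / real (k + 1) \<le> \<gamma> k \<and> \<gamma> k \<le> 1"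
  proof eventually_elim
    case (elim k)
    then show ?case
      using g[of k] divide_right_mono[of c "g k" "real (k + 1)"]
        divide_right_mono[of "g k" C "real (k + 1)"] by (simp add: \<gamma>_def)
  qed
  have "\<forall>\<^sub>F k in sequentially. u k \<le> a + \<epsilon> / 3 + \<epsilon> / 3"
  proof (rule relaxation_eventually_le[OF c _ \<gamma>])
    show "\<forall>\<^sub>F k in sequentially. u (Suc k) \<le> max ((1 - \<gamma> k) * u k + \<gamma> k * t k) \<bar>N (Suc k)\<bar>"
      using \<gamma> by eventually_elim (use step in auto)
    have q: "0 < 1 + 1 / c" using c by (simp add: add_pos_pos)
    then have "0 < \<epsilon> / 6 / (1 + 1 / c)" using \<epsilon> by simp
    from N0[OF this] have "\<forall>\<^sub>F k in sequentially. \<bar>N k\<bar> * (1 + 1 / c) \<le> \<epsilon> / 6"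
      by eventually_elim (simp only: pos_le_divide_eq[OF q])
    moreover have "\<forall>\<^sub>F k in sequentially. \<bar>y (Suc k) - xs\<bar> \<le> a + \<epsilon> / 6"
      using y[of "\<epsilon> / 6"] \<epsilon> eventually_sequentially_Suc[of "\<lambda>k. \<bar>y k - xs\<bar> \<le> a + \<epsilon> / 6"] by simp
    ultimately show "\<forall>\<^sub>F k in sequentially. t k \<le> a + \<epsilon> / 3"
      by eventually_elim (unfold t_def, linarith)
    have "\<forall>\<^sub>F k in sequentially. \<bar>N (Suc k)\<bar> \<le> \<epsilon> / 3"
      using N0[of "\<epsilon> / 3"] \<epsilon> eventually_sequentially_Suc[of "\<lambda>k. \<bar>N k\<bar> \<le> \<epsilon> / 3"] by simp
    then show "\<forall>\<^sub>F k in sequentially. \<bar>N (Suc k)\<bar> \<le> a + \<epsilon> / 3"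
      by eventually_elim (use a in simp)
  qed (use \<epsilon> in simp)
  moreover have "\<forall>\<^sub>F k in sequentially. \<bar>N k\<bar> \<le> \<epsilon> / 3"
    using \<epsilon> by (intro N0) simp
  ultimately show ?thesis
    by eventually_elim (auto simp: u_def)
qed

text \<open>With d neighbours the update is a relaxation of weight d/(k+1) towards the mean of the
  estimates. The weight may exceed 1 while k + 1 < d, which an eventual statement ignores.\<close>

lemma averaging_tracking:
  fixes x :: "nat \<Rightarrow> real" and xh :: "'j \<Rightarrow> nat \<Rightarrow> real"
  assumes S: "finite S" "S \<noteq> {}"
    and rec: "\<And>k. x (Suc k) = x k - 1 / real (k + 1) * (\<Sum>j\<in>S. x k - xh j k)"
    and xh: "\<And>j \<epsilon>. j \<in> S \<Longrightarrow> 0 < \<epsilon> \<Longrightarrow> \<forall>\<^sub>F k in sequentially. \<bar>xh j k - xs\<bar> \<le> a j + \<epsilon>"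
    and \<epsilon>: "0 < \<epsilon>"
  shows "\<forall>\<^sub>F k in sequentially. \<bar>x k - xs\<bar> \<le> (\<Sum>j\<in>S. a j) / real (card S) + \<epsilon>"
proof -
  define d where "d = real (card S)"
  have d: "1 \<le> d" using S by (simp add: d_def Suc_le_eq card_gt_0_iff)
  define t where "t k = (\<Sum>j\<in>S. \<bar>xh j k - xs\<bar>) / d" for k
  have "\<forall>\<^sub>F k in sequentially. \<forall>j\<in>S. \<bar>xh j k - xs\<bar> \<le> a j + \<epsilon> / 2"
    using S xh \<epsilon> by (intro eventually_ball_finite) auto
  then have t: "\<forall>\<^sub>F k in sequentially. t k \<le> (\<Sum>j\<in>S. a j) / d + \<epsilon> / 2"
  proof eventually_elim
    case (elim k)
    have "(\<Sum>j\<in>S. \<bar>xh j k - xs\<bar>) \<le> (\<Sum>j\<in>S. a j + \<epsilon> / 2)"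
      using elim by (intro sum_mono) auto
    also have "\<dots> = (\<Sum>j\<in>S. a j) + d * (\<epsilon> / 2)"
      by (simp add: sum.distrib d_def)
    finally have "t k \<le> ((\<Sum>j\<in>S. a j) + d * (\<epsilon> / 2)) / d"
      using d unfolding t_def by (intro divide_right_mono) auto
    then show ?case
      using d by (simp add: add_divide_distrib)
  qed
  have big: "\<forall>\<^sub>F k in sequentially. d \<le> real (k + 1)"
    by real_asymp
  have "\<forall>\<^sub>F k in sequentially. \<bar>x k - xs\<bar> \<le> (\<Sum>j\<in>S. a j) / d + \<epsilon> / 2 + \<epsilon> / 2"
  \<comment> \<open>No projection acts on the states, so the alternative s of the relaxation lemma
    is simply filled with t again.\<close>
  proof (rule relaxation_eventually_le[OF _ _ _ _ t t])
    show "\<forall>\<^sub>F k in sequentially. 1 / real (k + 1) \<le> d / real (k + 1) \<and> d / real (k + 1) \<le> 1"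
      using big by eventually_elim (use d in \<open>auto simp: field_simps\<close>)
    show "\<forall>\<^sub>F k in sequentially. \<bar>x (Suc k) - xs\<bar> \<le>
        max ((1 - d / real (k + 1)) * \<bar>x k - xs\<bar> + d / real (k + 1) * t k) (t k)"
      using big
    proof eventually_elim
      case (elim k)
      have "x (Suc k) - xs = (1 - d / real (k + 1)) * (x k - xs)
          + (\<Sum>j\<in>S. xh j k - xs) / real (k + 1)"
        using rec[of k] by (simp add: sum_subtractf d_def divide_inverse algebra_simps)
      also have "\<bar>\<dots>\<bar> \<le> (1 - d / real (k + 1)) * \<bar>x k - xs\<bar> + \<bar>(\<Sum>j\<in>S. xh j k - xs) / real (k + 1)\<bar>"
        using elim by (intro order_trans[OF abs_triangle_ineq]) (simp add: abs_mult)
      also have "\<bar>(\<Sum>j\<in>S. xh j k - xs) / real (k + 1)\<bar> \<le> d / real (k + 1) * t k"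
        using d by (simp add: t_def divide_right_mono)
      finally show ?case by simp
    qed
  qed (use \<epsilon> in auto)
  then show ?thesis by (simp add: d_def add.commute)
qed

text \<open>The number \<alpha> is the limsup, obtained as the infimum of the eventual upper bounds.
  The slack \<epsilon> is essential, since the limsup itself need not be an eventual bound.\<close>

lemma least_asymptotic_bound_exists:
  fixes u :: "nat \<Rightarrow> real"
  assumes "\<And>k. 0 \<le> u k" "\<And>k. u k \<le> B"
  shows "\<exists>\<alpha>\<ge>0. \<forall>a. (\<forall>\<epsilon>>0. \<forall>\<^sub>F k in sequentially. u k \<le> a + \<epsilon>) \<longleftrightarrow> \<alpha> \<le> a"
proof -
  define A where "A = {a. \<forall>\<^sub>F k in sequentially. u k \<le> a}"
  have "B \<in> A" using assms(2) by (simp add: A_def)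
  then have ne: "A \<noteq> {}" by blast
  have nonneg: "0 \<le> a" if "a \<in> A" for a
  proof -
    from that have "\<exists>k. u k \<le> a"
      unfolding A_def by (auto dest: eventually_happens)
    then show ?thesis using assms(1) order_trans by blast
  qed
  then have bdd: "bdd_below A" by (rule bdd_belowI)
  have mem: "b \<in> A" if "Inf A < b" for b
  proof -
    obtain a where "a \<in> A" "a < b"
      using \<open>Inf A < b\<close> by (auto simp: cInf_less_iff[OF ne bdd])
    then show ?thesis by (auto simp: A_def elim: eventually_mono)
  qed
  have "(\<forall>\<epsilon>>0. \<forall>\<^sub>F k in sequentially. u k \<le> a + \<epsilon>) \<longleftrightarrow> Inf A \<le> a" for a
  proof
    assume "\<forall>\<epsilon>>0. \<forall>\<^sub>F k in sequentially. u k \<le> a + \<epsilon>"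
    then have "Inf A \<le> a + \<epsilon>" if "0 < \<epsilon>" for \<epsilon>
      using that by (intro cInf_lower bdd) (auto simp: A_def)
    then show "Inf A \<le> a" by (rule field_le_epsilon)
  next
    assume "Inf A \<le> a"
    then show "\<forall>\<epsilon>>0. \<forall>\<^sub>F k in sequentially. u k \<le> a + \<epsilon>"
      using mem by (auto simp: A_def)
  qed
  moreover have "0 \<le> Inf A" using ne nonneg by (intro cInf_greatest)
  ultimately show ?thesis by blast
qed

section \<open>Maximum principle on the directed graph\<close>

lemma spanning_tree_nbrs_nonempty:
  assumes "directed_spanning_tree V E r T" "i \<in> V" "i \<noteq> r"
  shows "nbrs E i \<noteq> {}"
  using assms unfolding directed_spanning_tree_def nbrs_def by blast

text \<open>At a follower where the maximum is attained, it is at most a mean of values that do not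
  exceed it, so every neighbour attains it too. Following tree edges backwards carries the maximum
  to the leader, where the value is at most 0.\<close>

lemma maximum_principle:
  fixes \<alpha> :: "nat \<Rightarrow> real"
  assumes graph: "E \<subseteq> {..n} \<times> {..n}" and tree: "directed_spanning_tree {..n} E n T"
    and root: "\<alpha> n \<le> 0"
    and mean: "\<And>i. i < n \<Longrightarrow> \<alpha> i \<le> (\<Sum>j\<in>nbrs E i. \<alpha> j) / real (card (nbrs E i))"
    and i: "i \<le> n"
  shows "\<alpha> i \<le> 0"
proof -
  define \<mu> where "\<mu> = Max (\<alpha> ` {..n})"
  have le: "\<alpha> j \<le> \<mu>" if "j \<le> n" for j
    using that by (simp add: \<mu>_def)
  have fin: "finite (nbrs E v)" for v
    by (rule finite_subset[of _ "{..n}"]) (use graph in \<open>auto simp: nbrs_def\<close>)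
  have nb: "u \<le> n" if "u \<in> nbrs E v" for u v
    using that graph by (auto simp: nbrs_def)
  have max_nbr: "\<alpha> u = \<mu>" if v: "v < n" "\<alpha> v = \<mu>" and u: "u \<in> nbrs E v" for u v
  proof (rule ccontr)
    assume "\<alpha> u \<noteq> \<mu>"
    then have "\<alpha> u < \<mu>" using le nb[OF u] by (simp add: less_le)
    then have "(\<Sum>j\<in>nbrs E v. \<alpha> j) < (\<Sum>j\<in>nbrs E v. \<mu>)"
      using fin u nb le by (intro sum_strict_mono_ex1) auto
    moreover have "0 < card (nbrs E v)"
      using fin u by (auto simp: card_gt_0_iff)
    ultimately have "(\<Sum>j\<in>nbrs E v. \<alpha> j) / real (card (nbrs E v)) < \<mu>"
      by (simp add: field_simps)
    with mean[OF v(1)] v(2) show False by simp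
  qed
  \<comment> \<open>The induction grows the path from the root, so the claim is an implication
    backwards along it: a maximum at the far end forces one at the root. The new end is a follower,
    as no tree edge enters the root.\<close>
  have root_max: "\<alpha> v = \<mu> \<longrightarrow> \<alpha> n = \<mu>" if "(n, v) \<in> T\<^sup>*" for v
    using that
  proof (induction rule: rtrancl_induct)
    case (step y z)
    have "z \<le> n" "z \<noteq> n" "y \<in> nbrs E z"
      using step(2) tree by (auto simp: directed_spanning_tree_def nbrs_def)
    then show ?case using step.IH max_nbr[of z y] by auto
  qed simp
  have "\<mu> \<in> \<alpha> ` {..n}" unfolding \<mu>_def by (rule Max_in) auto
  then obtain v where "v \<le> n" "\<alpha> v = \<mu>" by auto
  then have "\<alpha> n = \<mu>"
    using root_max[of v] tree by (simp add: directed_spanning_tree_def)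
  then show ?thesis using root le[OF i] by simp
qed

text \<open>The largest asymptotic deviations of the states are dominated by their averages over the
  neighbours, so the maximum principle propagates convergence from the leader along the tree.\<close>
lemma crs_path_converges:
  fixes x :: "nat \<Rightarrow> nat \<Rightarrow> real" and xh m g :: "nat \<Rightarrow> nat \<Rightarrow> nat \<Rightarrow> real"
  assumes graph: "E \<subseteq> {..n} \<times> {..n}" and tree: "directed_spanning_tree {..n} E n T"
    and bounded: "\<And>i k. i \<le> n \<Longrightarrow> \<bar>x i k\<bar> \<le> R"
    and xs: "\<bar>xs\<bar> \<le> W"
    and root: "x n \<longlonglongrightarrow> xs"
    and x_rec: "\<And>i k. i < n \<Longrightarrow>
        x i (Suc k) = x i k - 1 / real (k + 1) * (\<Sum>j\<in>nbrs E i. x i k - xh i j k)"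
    and c: "0 < c"
    and g: "\<And>i j k. i < n \<Longrightarrow> j \<in> nbrs E i \<Longrightarrow> c \<le> g i j k"
      "\<And>i j k. i < n \<Longrightarrow> j \<in> nbrs E i \<Longrightarrow> g i j k \<le> C"
    and xh_rec: "\<And>i j k. i < n \<Longrightarrow> j \<in> nbrs E i \<Longrightarrow> xh i j (Suc k) = closest_point {- W..W}
        (xh i j k - g i j k / real (k + 1) * (xh i j k - x j (Suc k))
          + \<beta> / real (k + 1) * m i j (Suc k))"
    and noise: "\<And>i j. i < n \<Longrightarrow> j \<in> nbrs E i \<Longrightarrow>
        (\<lambda>k. (\<Sum>l=1..k. m i j l) / real k) \<longlonglongrightarrow> 0"
  shows "i \<le> n \<Longrightarrow> x i \<longlonglongrightarrow> xs"
    and "i < n \<Longrightarrow> j \<in> nbrs E i \<Longrightarrow> xh i j \<longlonglongrightarrow> xs"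
proof -
  have fin: "finite (nbrs E v)" for v
    by (rule finite_subset[of _ "{..n}"]) (use graph in \<open>auto simp: nbrs_def\<close>)
  have nb: "u \<le> n" if "u \<in> nbrs E v" for u v
    using that graph by (auto simp: nbrs_def)
  have "\<exists>\<alpha>\<ge>0. \<forall>a. (\<forall>\<epsilon>>0. \<forall>\<^sub>F k in sequentially. \<bar>x i k - xs\<bar> \<le> a + \<epsilon>) \<longleftrightarrow> \<alpha> \<le> a"
    if "i \<le> n" for i
    using bounded[OF that] xs
    by (intro least_asymptotic_bound_exists[where B = "R + W"]) (auto intro: order_trans[OF abs_triangle_ineq4] add_mono)
  then obtain \<alpha> where \<alpha>: "\<And>i. i \<le> n \<Longrightarrow> 0 \<le> \<alpha> i"
      "\<And>i a. i \<le> n \<Longrightarrow> (\<forall>\<epsilon>>0. \<forall>\<^sub>F k in sequentially. \<bar>x i k - xs\<bar> \<le> a + \<epsilon>) \<longleftrightarrow> \<alpha> i \<le> a"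
    by metis
  have xh_bound: "\<forall>\<^sub>F k in sequentially. \<bar>xh i j k - xs\<bar> \<le> \<alpha> j + \<epsilon>"
    if ij: "i < n" "j \<in> nbrs E i" and "0 < \<epsilon>" for i j \<epsilon>
  proof (rule projected_tracking[OF c g[OF ij] xs xh_rec[OF ij] noise[OF ij]])
    have j: "j \<le> n" using nb[OF ij(2)] .
    show "\<forall>\<^sub>F k in sequentially. \<bar>x j k - xs\<bar> \<le> \<alpha> j + \<epsilon>" if "0 < \<epsilon>" for \<epsilon>
      using \<alpha>(2)[OF j, of "\<alpha> j"] that by simp
    show "0 \<le> \<alpha> j" by (rule \<alpha>(1)[OF j])
  qed (rule \<open>0 < \<epsilon>\<close>)
  have zero: "\<alpha> i = 0" if "i \<le> n" for i
  proof (rule antisym)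
    show "\<alpha> i \<le> 0"
    proof (rule maximum_principle[OF graph tree _ _ that])
      have "\<forall>\<^sub>F k in sequentially. \<bar>x n k - xs\<bar> \<le> 0 + \<epsilon>" if "0 < \<epsilon>" for \<epsilon>
        using tendstoD[OF root that] by eventually_elim (simp add: dist_real_def)
      then show "\<alpha> n \<le> 0" using \<alpha>(2)[of n 0] by simp
      fix v assume v: "v < n"
      have "nbrs E v \<noteq> {}"
        using spanning_tree_nbrs_nonempty[OF tree] v by simp
      from averaging_tracking[OF fin this x_rec[OF v] xh_bound[OF v]]
      show "\<alpha> v \<le> (\<Sum>j\<in>nbrs E v. \<alpha> j) / real (card (nbrs E v))"
        using \<alpha>(2)[of v] v by auto
    qed
  qed (rule \<alpha>(1)[OF that])
  have lim: "u \<longlonglongrightarrow> xs" if "\<And>\<epsilon>. 0 < \<epsilon> \<Longrightarrow> \<forall>\<^sub>F k in sequentially. \<bar>u k - xs\<bar> \<le> 0 + \<epsilon>" for u :: "nat \<Rightarrow> real"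
  proof (rule tendstoI)
    fix e :: real assume "0 < e"
    then have "\<forall>\<^sub>F k in sequentially. \<bar>u k - xs\<bar> \<le> 0 + e / 2" by (intro that) simp
    then show "\<forall>\<^sub>F k in sequentially. dist (u k) xs < e"
      by eventually_elim (use \<open>0 < e\<close> in \<open>auto simp: dist_real_def\<close>)
  qed
  show "x i \<longlonglongrightarrow> xs" if "i \<le> n"
    using \<alpha>(2)[OF that, of 0] zero[OF that] by (intro lim) auto
  show "xh i j \<longlonglongrightarrow> xs" if "i < n" "j \<in> nbrs E i"
    using xh_bound[OF that] zero[OF nb[OF that(2)]] by (intro lim) auto
qed

section \<open>Slopes of the normal distribution function, and its inversion of observations\<close>

section \<open>Observation noise\<close>

lemma normal_density_bounds:
  assumes "0 < \<sigma>" "\<bar>z\<bar> \<le> K"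
  shows "normal_density 0 \<sigma> K \<le> normal_density 0 \<sigma> z" "normal_density 0 \<sigma> z \<le> normal_density 0 \<sigma> 0"
proof -
  have "z\<^sup>2 \<le> K\<^sup>2" using assms by (simp add: abs_le_square_iff[symmetric])
  then show "normal_density 0 \<sigma> K \<le> normal_density 0 \<sigma> z" "normal_density 0 \<sigma> z \<le> normal_density 0 \<sigma> 0"
    using assms by (auto simp: normal_density_def divide_right_mono intro!: divide_right_mono)
qed

text \<open>On [-K, K] the density lies between its values at K and at 0; integrating over the
  interval between x and y gives both bounds.\<close>

lemma normal_cdf_diff_bounds:
  assumes \<sigma>: "0 < \<sigma>" and xy: "- K \<le> x" "x \<le> y" "y \<le> K"
  shows "normal_density 0 \<sigma> K * (y - x) \<le> normal_cdf \<sigma> y - normal_cdf \<sigma> x"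
    and "normal_cdf \<sigma> y - normal_cdf \<sigma> x \<le> normal_density 0 \<sigma> 0 * (y - x)"
proof -
  interpret D: prob_space "density lborel (normal_density 0 \<sigma>)"
    by (rule prob_space_normal_density[OF \<sigma>])
  interpret D: real_distribution "density lborel (normal_density 0 \<sigma>)"
    by standard auto
  have eq: "normal_cdf \<sigma> y - normal_cdf \<sigma> x = (\<integral>z. indicator {x<..y} z * normal_density 0 \<sigma> z \<partial>lborel)"
  proof (cases "x < y")
    case True
    have "normal_cdf \<sigma> y - normal_cdf \<sigma> x = measure (density lborel (normal_density 0 \<sigma>)) {x<..y}"
      unfolding normal_cdf_def by (rule D.cdf_diff_eq[OF True])
    also have "\<dots> = (\<integral>z. indicator {x<..y} z \<partial>density lborel (normal_density 0 \<sigma>))"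
      by simp
    also have "\<dots> = (\<integral>z. normal_density 0 \<sigma> z *\<^sub>R indicator {x<..y} z \<partial>lborel)"
      by (subst integral_density) auto
    finally show ?thesis by (simp add: mult.commute)
  qed (use xy in simp)
  have I: "integrable lborel (\<lambda>z. indicator {x<..y} z * normal_density 0 \<sigma> z)"
    using integrable_mult_indicator[OF _ integrable_normal_density[OF \<sigma>], of "{x<..y}" 0] by simp
  have const: "integrable lborel (\<lambda>z. indicator {x<..y} z * c)"
      "(\<integral>z. indicator {x<..y} z * c \<partial>lborel) = c * (y - x)" for c :: real
    using xy by (auto simp: mult.commute)
  have "indicator {x<..y} z * normal_density 0 \<sigma> K \<le> indicator {x<..y} z * normal_density 0 \<sigma> z"
    "indicator {x<..y} z * normal_density 0 \<sigma> z \<le> indicator {x<..y} z * normal_density 0 \<sigma> 0" for z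
    using xy normal_density_bounds[OF \<sigma>, of z K] by (auto simp: indicator_def)
  then show "normal_density 0 \<sigma> K * (y - x) \<le> normal_cdf \<sigma> y - normal_cdf \<sigma> x"
    "normal_cdf \<sigma> y - normal_cdf \<sigma> x \<le> normal_density 0 \<sigma> 0 * (y - x)"
    unfolding eq const(2)[symmetric] by (intro integral_mono const(1) I; blast)+
qed

lemma normal_cdf_strict_mono:
  assumes "0 < \<sigma>" "x < y"
  shows "normal_cdf \<sigma> x < normal_cdf \<sigma> y"
proof -
  have "0 < normal_density 0 \<sigma> (max \<bar>x\<bar> \<bar>y\<bar>) * (y - x)"
    using assms by (simp add: normal_density_pos)
  then show ?thesis
    using normal_cdf_diff_bounds(1)[OF assms(1), of "max \<bar>x\<bar> \<bar>y\<bar>" x y] assms by linarith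
qed

lemma normal_cdf_range:
  assumes "0 < \<sigma>"
  shows "0 < normal_cdf \<sigma> z" "normal_cdf \<sigma> z < 1"
proof -
  interpret D: prob_space "density lborel (normal_density 0 \<sigma>)"
    by (rule prob_space_normal_density[OF assms])
  interpret D: real_distribution "density lborel (normal_density 0 \<sigma>)"
    by standard auto
  have "0 \<le> normal_cdf \<sigma> (z - 1)" "normal_cdf \<sigma> (z + 1) \<le> 1"
    by (simp_all add: normal_cdf_def D.cdf_nonneg D.cdf_bounded_prob)
  then show "0 < normal_cdf \<sigma> z" "normal_cdf \<sigma> z < 1"
    using normal_cdf_strict_mono[OF assms, of "z - 1" z] normal_cdf_strict_mono[OF assms, of z "z + 1"]
    by simp_all
qed

lemma borel_measurable_normal_cdf:
  assumes "0 < \<sigma>"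
  shows "normal_cdf \<sigma> \<in> borel_measurable borel"
  using normal_cdf_strict_mono[OF assms] by (intro borel_measurable_mono monoI) (auto simp: le_less)

text \<open>This linearises the estimate update with slopes bounded uniformly away from 0. The slope
  is the difference quotient; for u = v any admissible value serves, and the density at u shows that
  there is one.\<close>

lemma normal_cdf_secant:
  assumes \<sigma>: "0 < \<sigma>" and bd: "\<bar>u\<bar> \<le> K" "\<bar>v\<bar> \<le> K"
  shows "\<exists>g. normal_density 0 \<sigma> K \<le> g \<and> g \<le> normal_density 0 \<sigma> 0 \<and>
    normal_cdf \<sigma> u - normal_cdf \<sigma> v = g * (u - v)"
proof -
  have *: "\<exists>g. normal_density 0 \<sigma> K \<le> g \<and> g \<le> normal_density 0 \<sigma> 0 \<and>
      normal_cdf \<sigma> u - normal_cdf \<sigma> v = g * (u - v)" if "v < u" "\<bar>u\<bar> \<le> K" "\<bar>v\<bar> \<le> K" for u v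
    using that normal_cdf_diff_bounds[OF \<sigma>, of K v u]
    by (intro exI[of _ "(normal_cdf \<sigma> u - normal_cdf \<sigma> v) / (u - v)"])
      (auto simp: pos_le_divide_eq pos_divide_le_eq)
  consider "u = v" | "v < u" | "u < v" by linarith
  then show ?thesis
  proof cases
    case 1
    then show ?thesis using normal_density_bounds[OF \<sigma> bd(1)] by auto
  next
    case 2
    then show ?thesis using *[of v u] bd by blast
  next
    case 3
    then obtain g where "normal_density 0 \<sigma> K \<le> g" "g \<le> normal_density 0 \<sigma> 0"
        "normal_cdf \<sigma> v - normal_cdf \<sigma> u = g * (v - u)"
      using *[of u v] bd by blast
    then show ?thesis by (intro exI[of _ g]) (auto simp: algebra_simps)
  qed
qed

text \<open>Despite the projection, an observation can be read off two consecutive estimates, since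
  the increments for the two possible observations have opposite signs.\<close>
lemma observation_from_estimates:
  fixes e e' a F s W :: real
  assumes W: "0 < W" "\<bar>e\<bar> \<le> W" and a: "0 < a" and F: "0 < F" "F < 1"
    and s: "s = 0 \<or> s = 1"
    and e': "e' = closest_point {- W..W} (e + a * (F - s))"
  shows "s = (if e < e' \<or> e' = e \<and> e = W then 0 else 1)"
proof -
  have "0 < a * F \<and> a * (F - 1) < 0" using a F by (auto simp: mult_pos_neg)
  moreover define P Q where "P = a * F" and "Q = a * (F - 1)"
  ultimately have PQ: "0 < P" "Q < 0" by simp_all
  have e'_eq: "e' = max (- W) (min W (e + (if s = 0 then P else Q)))"
    using s W unfolding e' by (auto simp: closest_point_interval P_def Q_def)
  \<comment> \<open>Observation 0 pushes the estimate up, observation 1 down. The projection can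
    suppress the move only at an end point: an unmoved estimate lies at W in the first case and at
    -W in the second, and W > 0 separates the two.\<close>
  from s show ?thesis
  proof
    assume "s = 0"
    with PQ W e'_eq have "e' = min W (e + P)" by (simp add: max_def)
    with \<open>s = 0\<close> PQ W show ?thesis by (auto simp: min_def)
  next
    assume "s = 1"
    with PQ W e'_eq have "e' = max (- W) (e + Q)" by (simp add: min_def)
    with \<open>s = 1\<close> PQ W show ?thesis by (auto simp: max_def)
  qed
qed

section \<open>Centred observations and their averages\<close>

context prob_space
begin

text \<open>Given the past N, the observation equals 1 with probability F(c - X), so its centred
  version is orthogonal to every bounded Y known in the past. Independence makes the joint law a
  product, and Fubini integrates out the noise with Y and X frozen.\<close>

lemma noise_centered:
  assumes \<sigma>: "0 < \<sigma>" and \<xi>: "distributed M lborel \<xi> (normal_density 0 \<sigma>)"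
    and indep: "indep_set (sets (vimage_algebra (space M) \<xi> borel)) (sets N)"
    and space: "space N = space M"
    and Y: "Y \<in> borel_measurable N" and X: "X \<in> borel_measurable N"
    and bd: "\<And>\<omega>. \<omega> \<in> space M \<Longrightarrow> \<bar>Y \<omega>\<bar> \<le> B"
  shows "expectation (\<lambda>\<omega>. Y \<omega> * (normal_cdf \<sigma> (c - X \<omega>) - binary_obs c (X \<omega> + \<xi> \<omega>))) = 0"
proof -
  \<comment> \<open>Y and X may depend on each other, so they are kept together as one random pair;
    only this pair and the noise are independent.\<close>
  let ?Z = "\<lambda>\<omega>. (Y \<omega>, X \<omega>)"
  let ?B2 = "borel \<Otimes>\<^sub>M borel :: (real \<times> real) measure"
  have NM: "sets N \<subseteq> sets M" using indep_setD_ev2[OF indep] .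
  have mono: "f \<in> borel_measurable M" if "f \<in> borel_measurable N" for f :: "_ \<Rightarrow> real"
    using measurable_mono[OF subset_refl refl NM space] that by blast
  have [measurable]: "\<xi> \<in> borel_measurable M"
    using distributed_measurable[OF \<xi>] by simp
  have YM[measurable]: "Y \<in> borel_measurable M" and XM[measurable]: "X \<in> borel_measurable M"
    by (rule mono[OF Y], rule mono[OF X])
  note [measurable] = borel_measurable_normal_cdf[OF \<sigma>]
  have ZN: "?Z \<in> measurable N ?B2" using X Y by measurable
  interpret P: prob_space "distr M borel \<xi>" by (rule prob_space_distr) measurable
  interpret Q: prob_space "distr M ?B2 ?Z" by (rule prob_space_distr) measurable
  interpret PQ: pair_prob_space "distr M borel \<xi>" "distr M ?B2 ?Z" ..
  have dist: "distr M borel \<xi> \<Otimes>\<^sub>M distr M ?B2 ?Z = distr M (borel \<Otimes>\<^sub>M ?B2) (\<lambda>\<omega>. (\<xi> \<omega>, ?Z \<omega>))"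
  proof (rule pair_measure_eqI)
    fix A B assume "A \<in> sets (distr M borel \<xi>)" "B \<in> sets (distr M ?B2 ?Z)"
    then have A[measurable]: "A \<in> sets borel" and B[measurable]: "B \<in> sets ?B2" by auto
    have "\<xi> -` A \<inter> space M \<in> sets (vimage_algebra (space M) \<xi> borel)"
      using A by (auto simp: sets_vimage_algebra2)
    moreover have "?Z -` B \<inter> space M \<in> sets N"
      using measurable_sets[OF ZN B] space by simp
    ultimately have "prob ((\<xi> -` A \<inter> space M) \<inter> (?Z -` B \<inter> space M))
        = prob (\<xi> -` A \<inter> space M) * prob (?Z -` B \<inter> space M)"
      by (rule indep_setD[OF indep])
    moreover have "(\<xi> -` A \<inter> space M) \<inter> (?Z -` B \<inter> space M) = (\<lambda>\<omega>. (\<xi> \<omega>, ?Z \<omega>)) -` (A \<times> B) \<inter> space M"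
      by auto
    ultimately show "emeasure (distr M borel \<xi>) A * emeasure (distr M ?B2 ?Z) B
        = emeasure (distr M (borel \<Otimes>\<^sub>M ?B2) (\<lambda>\<omega>. (\<xi> \<omega>, ?Z \<omega>))) (A \<times> B)"
      by (simp add: emeasure_distr emeasure_eq_measure ennreal_mult'')
  qed (auto intro: P.sigma_finite_measure_axioms Q.sigma_finite_measure_axioms)
  define h where "h z p = fst p * binary_obs c (snd p + z)" for z :: real and p :: "real \<times> real"
  have hm[measurable]: "case_prod h \<in> borel_measurable (borel \<Otimes>\<^sub>M ?B2)"
  proof -
    have "(\<lambda>q. fst (snd q) * (if snd (snd q) + fst q \<le> c then 1 else 0)) \<in> borel_measurable (borel \<Otimes>\<^sub>M ?B2)"
      by measurable
    then show ?thesis by (simp add: h_def binary_obs_def case_prod_beta')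
  qed
  have "B \<ge> 0" using bd not_empty by fastforce
  have int_obs: "integrable M (\<lambda>\<omega>. Y \<omega> * binary_obs c (X \<omega> + \<xi> \<omega>))"
  proof (rule integrable_const_bound[of _ B])
    show "AE \<omega> in M. norm (Y \<omega> * binary_obs c (X \<omega> + \<xi> \<omega>)) \<le> B"
      using bd \<open>B \<ge> 0\<close> by (auto simp: binary_obs_def abs_mult)
    show "(\<lambda>\<omega>. Y \<omega> * binary_obs c (X \<omega> + \<xi> \<omega>)) \<in> borel_measurable M"
      unfolding binary_obs_def by measurable
  qed
  have int_cdf: "integrable M (\<lambda>\<omega>. Y \<omega> * normal_cdf \<sigma> (c - X \<omega>))"
  proof (rule integrable_const_bound[of _ B])
    have "\<bar>normal_cdf \<sigma> z\<bar> \<le> 1" for z using normal_cdf_range[OF \<sigma>, of z] by simp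
    then show "AE \<omega> in M. norm (Y \<omega> * normal_cdf \<sigma> (c - X \<omega>)) \<le> B"
      using bd mult_mono[of _ B _ 1] \<open>B \<ge> 0\<close> by (auto simp: abs_mult)
  qed measurable
  have inner: "(\<integral>z. h z p \<partial>distr M borel \<xi>) = fst p * normal_cdf \<sigma> (c - snd p)" for p
  proof -
    have "distr M borel \<xi> = density lborel (normal_density 0 \<sigma>)"
      using distributed_distr_eq_density[OF \<xi>] by (simp cong: distr_cong)
    moreover have "h z p = fst p * indicator {..c - snd p} z" for z
      by (auto simp: h_def binary_obs_def indicator_def)
    ultimately show ?thesis
      by (simp add: normal_cdf_def cdf_def)
  qed
  have "expectation (\<lambda>\<omega>. Y \<omega> * binary_obs c (X \<omega> + \<xi> \<omega>))
      = (\<integral>q. case_prod h q \<partial>distr M (borel \<Otimes>\<^sub>M ?B2) (\<lambda>\<omega>. (\<xi> \<omega>, ?Z \<omega>)))"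
    by (subst integral_distr) (auto simp: h_def)
  also have "\<dots> = (\<integral>p. (\<integral>z. h z p \<partial>distr M borel \<xi>) \<partial>distr M ?B2 ?Z)"
    unfolding dist[symmetric]
  proof (rule PQ.integral_snd[symmetric])
    show "integrable (distr M borel \<xi> \<Otimes>\<^sub>M distr M ?B2 ?Z) (case_prod h)"
      unfolding dist by (subst integrable_distr_eq) (use int_obs in \<open>auto simp: h_def\<close>)
  qed
  also have "\<dots> = (\<integral>p. fst p * normal_cdf \<sigma> (c - snd p) \<partial>distr M ?B2 ?Z)"
    by (simp add: inner)
  also have "\<dots> = expectation (\<lambda>\<omega>. Y \<omega> * normal_cdf \<sigma> (c - X \<omega>))"
    by (subst integral_distr) auto
  finally show ?thesis
    using int_obs int_cdf by (simp add: right_diff_distrib)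
qed

text \<open>Along the squares the second moments of the averages are summable, and between consecutive
  squares the averages move little because the summands are bounded.\<close>
lemma orthogonal_bounded_averages:
  fixes m :: "nat \<Rightarrow> 'a \<Rightarrow> real"
  assumes meas[measurable]: "\<And>l. m l \<in> borel_measurable M"
    and bd: "\<And>l \<omega>. \<omega> \<in> space M \<Longrightarrow> \<bar>m l \<omega>\<bar> \<le> 1"
    and orth: "\<And>k. expectation (\<lambda>\<omega>. (\<Sum>l=1..k. m l \<omega>) * m (Suc k) \<omega>) = 0"
  shows "AE \<omega> in M. (\<lambda>k. (\<Sum>l=1..k. m l \<omega>) / real k) \<longlonglongrightarrow> 0"
proof -
  define S where "S k \<omega> = (\<Sum>l=1..k. m l \<omega>)" for k \<omega>
  have [measurable]: "S k \<in> borel_measurable M" for k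
    unfolding S_def by measurable
  have S_gap: "\<bar>S l \<omega> - S k \<omega>\<bar> \<le> real (l - k)" if "k \<le> l" "\<omega> \<in> space M" for k l \<omega>
    using that(1)
  proof (induction l rule: dec_induct)
    case (step l)
    then show ?case using bd[OF that(2), of "Suc l"] by (simp add: S_def Suc_diff_le)
  qed simp
  have S_bd: "\<bar>S k \<omega>\<bar> \<le> real k" if "\<omega> \<in> space M" for k \<omega>
    using S_gap[of 0 k, OF _ that] by (simp add: S_def)
  have int: "integrable M (\<lambda>\<omega>. (S k \<omega>)\<^sup>2)" for k
    by (rule integrable_const_bound[of _ "(real k)\<^sup>2"])
      (use S_bd in \<open>auto simp: abs_le_square_iff[symmetric]\<close>)
  have int_prod: "integrable M (\<lambda>\<omega>. S k \<omega> * m l \<omega>)" for k l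
  proof (rule integrable_const_bound)
    show "AE \<omega> in M. norm (S k \<omega> * m l \<omega>) \<le> real k * 1"
      unfolding real_norm_def abs_mult by (intro AE_I2 mult_mono S_bd bd) auto
  qed measurable
  have int_m: "integrable M (\<lambda>\<omega>. (m l \<omega>)\<^sup>2)" for l
    by (rule integrable_const_bound[of _ 1]) (use bd in \<open>auto simp: abs_square_le_1\<close>)
  \<comment> \<open>Orthogonality removes the cross term, so each step adds at most 1 to the second
    moment.\<close>
  have var: "expectation (\<lambda>\<omega>. (S k \<omega>)\<^sup>2) \<le> real k" for k
  proof (induction k)
    case (Suc k)
    have "expectation (\<lambda>\<omega>. (S (Suc k) \<omega>)\<^sup>2)
        = expectation (\<lambda>\<omega>. (S k \<omega>)\<^sup>2 + 2 * (S k \<omega> * m (Suc k) \<omega>) + (m (Suc k) \<omega>)\<^sup>2)"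
      by (intro Bochner_Integration.integral_cong) (auto simp: S_def power2_eq_square algebra_simps)
    also have "\<dots> = expectation (\<lambda>\<omega>. (S k \<omega>)\<^sup>2) + 2 * expectation (\<lambda>\<omega>. S k \<omega> * m (Suc k) \<omega>)
        + expectation (\<lambda>\<omega>. (m (Suc k) \<omega>)\<^sup>2)"
      using int int_prod int_m by simp
    also have "expectation (\<lambda>\<omega>. S k \<omega> * m (Suc k) \<omega>) = 0"
      using orth by (simp add: S_def)
    also have "expectation (\<lambda>\<omega>. (m (Suc k) \<omega>)\<^sup>2) \<le> expectation (\<lambda>\<omega>. 1)"
      by (intro integral_mono int_m) (use bd in \<open>auto simp: abs_square_le_1\<close>)
    finally show ?case using Suc by (simp add: prob_space)
  qed (simp add: S_def)
  \<comment> \<open>This is the squared average at the square index (r+1)^2. The variance bound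
    gives it expectation at most 1/(r+1)^2, which is summable; the shift by one avoids a zero
    denominator.\<close>
  define u where "u r \<omega> = (S ((Suc r)\<^sup>2) \<omega>)\<^sup>2 / real (Suc r) ^ 4" for r \<omega>
  have [measurable]: "u r \<in> borel_measurable M" for r
    unfolding u_def by measurable
  have Eu: "(\<integral>\<^sup>+\<omega>. ennreal (u r \<omega>) \<partial>M) \<le> ennreal (1 / real (Suc r) ^ 2)" for r
  proof -
    have "(\<integral>\<^sup>+\<omega>. ennreal (u r \<omega>) \<partial>M) = ennreal (expectation (u r))"
      unfolding u_def by (intro nn_integral_eq_integral integrable_divide int) auto
    also have "expectation (u r) \<le> real ((Suc r)\<^sup>2) / real (Suc r) ^ 4"
      unfolding u_def by (simp add: divide_right_mono var del: of_nat_Suc of_nat_power)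
    also have "\<dots> = 1 / real (Suc r) ^ 2"
    proof -
      have "a ^ 2 / a ^ 4 = 1 / a ^ 2" if "a \<noteq> 0" for a :: real
        using that by (simp add: field_simps power2_eq_square power4_eq_xxxx)
      from this[of "real (Suc r)"] show ?thesis by (simp del: of_nat_Suc)
    qed
    finally show ?thesis by (auto intro: ennreal_leI)
  qed
  have "(\<integral>\<^sup>+\<omega>. (\<Sum>r. ennreal (u r \<omega>)) \<partial>M) = (\<Sum>r. \<integral>\<^sup>+\<omega>. ennreal (u r \<omega>) \<partial>M)"
    by (rule nn_integral_suminf) measurable
  also have "\<dots> \<le> (\<Sum>r. ennreal (1 / real (Suc r) ^ 2))"
    by (intro suminf_le Eu) auto
  also have "\<dots> < \<infinity>"
  proof -
    have "summable (\<lambda>r. 1 / real (Suc r) ^ 2)"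
      using inverse_power_summable[of 2, where ?'a = real] summable_Suc_iff[of "\<lambda>r. inverse (real r ^ 2)"]
      by (simp add: inverse_eq_divide del: of_nat_Suc)
    then have "(\<Sum>r. ennreal (1 / real (Suc r) ^ 2)) \<noteq> \<infinity>"
      unfolding infinity_ennreal_def
      by (rule ennreal_suminf_neq_top) (rule divide_nonneg_nonneg, rule zero_le_one, rule zero_le_power2)
    then show ?thesis unfolding infinity_ennreal_def by (simp only: less_top)
  qed
  finally have fin: "(\<integral>\<^sup>+\<omega>. (\<Sum>r. ennreal (u r \<omega>)) \<partial>M) < \<infinity>" .
  \<comment> \<open>A series with finite expectation converges on almost every path, so its terms
    tend to 0 there.\<close>
  have "AE \<omega> in M. (\<Sum>r. ennreal (u r \<omega>)) \<noteq> \<infinity>"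
  proof (rule nn_integral_PInf_AE)
    show "(\<lambda>\<omega>. \<Sum>r. ennreal (u r \<omega>)) \<in> borel_measurable M" by measurable
    show "(\<integral>\<^sup>+\<omega>. (\<Sum>r. ennreal (u r \<omega>)) \<partial>M) \<noteq> \<infinity>" using fin by (rule less_imp_neq)
  qed
  then show ?thesis
  proof (rule AE_mp, intro AE_I2 impI)
    fix \<omega> assume \<omega>: "\<omega> \<in> space M" and fin: "(\<Sum>r. ennreal (u r \<omega>)) \<noteq> \<infinity>"
    have "summable (\<lambda>r. u r \<omega>)"
    proof (rule summable_suminf_not_top)
      show "0 \<le> u r \<omega>" for r unfolding u_def by (intro divide_nonneg_nonneg zero_le_power2) simp
    qed (rule fin[unfolded infinity_ennreal_def])
    then have "(\<lambda>r. u r \<omega>) \<longlonglongrightarrow> 0" by (rule summable_LIMSEQ_zero)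
    then have "(\<lambda>r. sqrt (u r \<omega>)) \<longlonglongrightarrow> 0"
      using tendsto_real_sqrt[of "\<lambda>r. u r \<omega>" 0] by simp
    moreover have "sqrt (u r \<omega>) = \<bar>S ((Suc r)\<^sup>2) \<omega>\<bar> / real (Suc r) ^ 2" for r
    proof -
      have "sqrt (real (Suc r) ^ 4) = real (Suc r) ^ 2"
        by (rule real_sqrt_unique) (simp_all flip: power_mult)
      then show ?thesis by (simp add: u_def real_sqrt_divide del: of_nat_Suc)
    qed
    ultimately have "(\<lambda>r. \<bar>S ((Suc r)\<^sup>2) \<omega>\<bar> / real (Suc r) ^ 2) \<longlonglongrightarrow> 0"
      by (simp only:)
    then have "(\<lambda>r. \<bar>S (r\<^sup>2) \<omega>\<bar> / real r ^ 2) \<longlonglongrightarrow> 0"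
      by (rule LIMSEQ_imp_Suc[of "\<lambda>r. \<bar>S (r\<^sup>2) \<omega>\<bar> / real r ^ 2"])
    moreover have "(\<lambda>r. 2 / real r) \<longlonglongrightarrow> 0" by real_asymp
    ultimately have "(\<lambda>r. \<bar>S (r\<^sup>2) \<omega>\<bar> / real r ^ 2 + 2 / real r) \<longlonglongrightarrow> 0 + 0"
      by (rule tendsto_add)
    moreover have "filterlim floor_sqrt at_top sequentially"
      unfolding filterlim_at_top
    proof
      fix Z :: nat
      show "\<forall>\<^sub>F k in sequentially. Z \<le> floor_sqrt k"
        using eventually_ge_at_top[of "Z\<^sup>2"] by eventually_elim (simp add: le_floor_sqrt_iff)
    qed
    ultimately have lim: "(\<lambda>k. \<bar>S ((floor_sqrt k)\<^sup>2) \<omega>\<bar> / real (floor_sqrt k) ^ 2 + 2 / real (floor_sqrt k)) \<longlonglongrightarrow> 0"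
      using filterlim_compose[of "\<lambda>r. \<bar>S (r\<^sup>2) \<omega>\<bar> / real r ^ 2 + 2 / real r" "nhds (0 + 0)"]
      by simp
    \<comment> \<open>From r^2 up to k < (r+1)^2 there are at most 2r further summands of modulus at
      most 1; divided by k \<ge> r^2 they contribute at most 2/r.\<close>
    have "\<bar>S k \<omega> / real k\<bar> \<le> \<bar>S ((floor_sqrt k)\<^sup>2) \<omega>\<bar> / real (floor_sqrt k) ^ 2 + 2 / real (floor_sqrt k)"
      if k: "1 \<le> k" for k
    proof -
      define r where "r = floor_sqrt k"
      have r: "0 < r" using k le_floor_sqrt_iff[of 1 k] by (simp add: r_def)
      have rk: "r\<^sup>2 \<le> k" by (simp add: r_def floor_sqrt_power2_le)
      have "k < (Suc r)\<^sup>2" by (simp add: r_def Suc_floor_sqrt_power2_gt)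
      then have "k - r\<^sup>2 \<le> 2 * r" by (simp add: power2_eq_square)
      then have "\<bar>S k \<omega>\<bar> \<le> \<bar>S (r\<^sup>2) \<omega>\<bar> + 2 * real r"
        using S_gap[OF rk \<omega>] by linarith
      then have "\<bar>S k \<omega>\<bar> / real k \<le> (\<bar>S (r\<^sup>2) \<omega>\<bar> + 2 * real r) / real (r\<^sup>2)"
        using rk r by (intro frac_le) auto
      also have "\<dots> = \<bar>S (r\<^sup>2) \<omega>\<bar> / real r ^ 2 + 2 / real r"
        using r by (simp add: add_divide_distrib power2_eq_square)
      finally show ?thesis by (simp add: r_def)
    qed
    then have "norm (S k \<omega> / real k) \<le> \<bar>S ((floor_sqrt k)\<^sup>2) \<omega>\<bar> / real (floor_sqrt k) ^ 2 + 2 / real (floor_sqrt k)"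
      if "1 \<le> k" for k
      unfolding real_norm_def using that by blast
    then have "\<forall>\<^sub>F k in sequentially. norm (S k \<omega> / real k)
        \<le> \<bar>S ((floor_sqrt k)\<^sup>2) \<omega>\<bar> / real (floor_sqrt k) ^ 2 + 2 / real (floor_sqrt k)"
      by (rule eventually_sequentiallyI)
    from Lim_null_comparison[OF this lim]
    show "(\<lambda>k. (\<Sum>l=1..k. m l \<omega>) / real k) \<longlonglongrightarrow> 0"
      by (simp add: S_def)
  qed
qed

end

section \<open>Measurability in the past, uniform bounds, and assembly\<close>

section \<open>Mean-square convergence\<close>

text \<open>\<open>past_events\<close> is a plain family of sets that is already a sigma-algebra.
  Wrapping it as a measure makes measurability of functions with respect to the past
  expressible.\<close>

lemma sets_past_events:
  "sets (sigma (space M) (past_events M n E x xh k)) = past_events M n E x xh k"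
proof -
  have "past_events M n E x xh k \<subseteq> Pow (space M)"
    unfolding past_events_def by (rule subsetI, rule PowI, rule sigma_sets_into_sp[rotated], assumption) auto
  then have "sets (sigma (space M) (past_events M n E x xh k)) = sigma_sets (space M) (past_events M n E x xh k)"
    by (rule sets_measure_of)
  also have "\<dots> = past_events M n E x xh k"
    unfolding past_events_def by (rule sigma_sets_sigma_sets_eq) auto
  finally show ?thesis .
qed

lemma past_measurable_state:
  assumes "i \<le> n" "s \<le> k"
  shows "x i s \<in> borel_measurable (sigma (space M) (past_events M n E x xh k))"
proof (rule measurableI)
  fix A :: "real set" assume "A \<in> sets borel"
  then have "x i s -` A \<inter> space M \<in> past_events M n E x xh k"
    unfolding past_events_def using assms by (intro sigma_sets.Basic) blast
  then show "x i s -` A \<inter> space (sigma (space M) (past_events M n E x xh k))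
      \<in> sets (sigma (space M) (past_events M n E x xh k))"
    by (simp add: sets_past_events space_measure_of_conv)
qed simp

lemma past_measurable_estimate:
  assumes "i < n" "j \<in> nbrs E i" "s < k"
  shows "xh i j s \<in> borel_measurable (sigma (space M) (past_events M n E x xh k))"
proof (rule measurableI)
  fix A :: "real set" assume "A \<in> sets borel"
  then have "xh i j s -` A \<inter> space M \<in> past_events M n E x xh k"
    unfolding past_events_def using assms by (intro sigma_sets.Basic) blast
  then show "xh i j s -` A \<inter> space (sigma (space M) (past_events M n E x xh k))
      \<in> sets (sigma (space M) (past_events M n E x xh k))"
    by (simp add: sets_past_events space_measure_of_conv)
qed simp

text \<open>From k = D on, the weight d/(k+1) is at most 1 and the update is a convex combination,
  which preserves the bound. Each of the D steps before that enlarges it by a factor of at most 1 +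
  2 D.\<close>

lemma averaging_bounded:
  fixes x :: "nat \<Rightarrow> real" and xh :: "'j \<Rightarrow> nat \<Rightarrow> real"
  assumes D: "card S \<le> D" and W: "0 \<le> W"
    and rec: "\<And>k. x (Suc k) = x k - 1 / real (k + 1) * (\<Sum>j\<in>S. x k - xh j k)"
    and init: "\<bar>x 0\<bar> \<le> W" and xh: "\<And>j k. j \<in> S \<Longrightarrow> \<bar>xh j k\<bar> \<le> W"
  shows "\<bar>x k\<bar> \<le> (1 + 2 * real D) ^ D * W"
proof -
  define d where "d = real (card S)"
  have d: "0 \<le> d" "d \<le> real D" using D by (auto simp: d_def)
  define Q where "Q k = (1 + 2 * real D) ^ min k D * W" for k
  have WQ: "W \<le> Q k" for k
    using mult_right_mono[OF one_le_power[of "1 + 2 * real D" "min k D"] W] by (simp add: Q_def)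
  have "\<bar>x k\<bar> \<le> Q k"
  proof (induction k)
    case (Suc k)
    let ?r = "1 / real (k + 1)"
    have "\<bar>\<Sum>j\<in>S. xh j k\<bar> \<le> (\<Sum>j\<in>S. W)"
      using xh by (intro order_trans[OF sum_abs] sum_mono)
    then have s: "?r * \<bar>\<Sum>j\<in>S. xh j k\<bar> \<le> ?r * (d * W)"
      by (intro mult_left_mono) (auto simp: d_def)
    have x: "x (Suc k) = (1 - ?r * d) * x k + ?r * (\<Sum>j\<in>S. xh j k)"
      using rec[of k] by (simp add: sum_subtractf d_def algebra_simps)
    have "\<bar>x (Suc k)\<bar> \<le> \<bar>1 - ?r * d\<bar> * \<bar>x k\<bar> + ?r * \<bar>\<Sum>j\<in>S. xh j k\<bar>"
      unfolding x by (intro order_trans[OF abs_triangle_ineq]) (simp add: abs_mult)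
    also have "\<dots> \<le> \<bar>1 - ?r * d\<bar> * Q k + ?r * d * Q k"
    proof (rule add_mono)
      show "\<bar>1 - ?r * d\<bar> * \<bar>x k\<bar> \<le> \<bar>1 - ?r * d\<bar> * Q k"
        using Suc by (intro mult_left_mono) auto
      have "?r * d * W \<le> ?r * d * Q k"
        using d WQ by (intro mult_left_mono) auto
      with s show "?r * \<bar>\<Sum>j\<in>S. xh j k\<bar> \<le> ?r * d * Q k" by (simp add: mult.assoc)
    qed
    also have "\<dots> \<le> Q (Suc k)"
    proof (cases "k < D")
      case True
      have "?r * d \<le> 1 * d" using d by (intro mult_right_mono) auto
      moreover have "0 \<le> ?r * d" using d by simp
      ultimately have "\<bar>1 - ?r * d\<bar> + ?r * d \<le> 1 + 2 * real D"
        using d by linarith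
      then have "(\<bar>1 - ?r * d\<bar> + ?r * d) * Q k \<le> (1 + 2 * real D) * Q k"
        using WQ[of k] W by (intro mult_right_mono) auto
      also have "\<dots> = Q (Suc k)" using True by (simp add: Q_def min_def)
      finally show ?thesis by (simp add: distrib_right)
    next
      case False
      then have "?r * d \<le> 1" using d by (simp add: field_simps)
      then have "\<bar>1 - ?r * d\<bar> * Q k + ?r * d * Q k = Q k"
        by (simp add: algebra_simps)
      also have "\<dots> = Q (Suc k)" using False by (simp add: Q_def min_def)
      finally show ?thesis by simp
    qed
    finally show ?case .
  qed (use init in \<open>simp add: Q_def\<close>)
  also have "Q k \<le> (1 + 2 * real D) ^ D * W"
    unfolding Q_def using W by (intro mult_right_mono power_increasing) auto
  finally show ?thesis .
qed

lemma (in prob_space) mean_square_convergence: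
  fixes u v :: "nat \<Rightarrow> 'a \<Rightarrow> real"
  assumes [measurable]: "\<And>k. u k \<in> borel_measurable M" "\<And>k. v k \<in> borel_measurable M"
    and bd: "\<And>k \<omega>. \<omega> \<in> space M \<Longrightarrow> \<bar>u k \<omega>\<bar> \<le> R" "\<And>k \<omega>. \<omega> \<in> space M \<Longrightarrow> \<bar>v k \<omega>\<bar> \<le> R"
    and lim: "AE \<omega> in M. (\<lambda>k. u k \<omega>) \<longlonglongrightarrow> l \<and> (\<lambda>k. v k \<omega>) \<longlonglongrightarrow> l"
  shows "(\<lambda>k. expectation (\<lambda>\<omega>. (u k \<omega> - v k \<omega>)\<^sup>2)) \<longlonglongrightarrow> 0"
proof -
  have "(\<lambda>k. expectation (\<lambda>\<omega>. (u k \<omega> - v k \<omega>)\<^sup>2)) \<longlonglongrightarrow> expectation (\<lambda>\<omega>. 0)"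
  proof (rule integral_dominated_convergence[where w = "\<lambda>_. (2 * R)\<^sup>2"])
    show "AE \<omega> in M. (\<lambda>k. (u k \<omega> - v k \<omega>)\<^sup>2) \<longlonglongrightarrow> 0"
      using lim
    proof eventually_elim
      case (elim \<omega>)
      then have "(\<lambda>k. (u k \<omega> - v k \<omega>)\<^sup>2) \<longlonglongrightarrow> (l - l)\<^sup>2"
        by (intro tendsto_intros) auto
      then show ?case by simp
    qed
    show "AE \<omega> in M. norm ((u k \<omega> - v k \<omega>)\<^sup>2) \<le> (2 * R)\<^sup>2" for k
    proof (rule AE_I2)
      fix \<omega> assume "\<omega> \<in> space M"
      then have "\<bar>u k \<omega> - v k \<omega>\<bar> \<le> \<bar>2 * R\<bar>" using bd[of \<omega> k] by linarith
      then show "norm ((u k \<omega> - v k \<omega>)\<^sup>2) \<le> (2 * R)\<^sup>2" by (simp only: abs_le_square_iff real_norm_def abs_power2)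
    qed
  qed auto
  then show ?thesis by simp
qed

theorem theorem1:
  fixes M :: "'w measure"
    and n :: nat
    and E :: "(nat \<times> nat) set"
    and x :: "nat \<Rightarrow> nat \<Rightarrow> 'w \<Rightarrow> real"
    and xh :: "nat \<Rightarrow> nat \<Rightarrow> nat \<Rightarrow> 'w \<Rightarrow> real"
    and \<xi> :: "nat \<Rightarrow> nat \<Rightarrow> nat \<Rightarrow> 'w \<Rightarrow> real"
    and x0 :: "nat \<Rightarrow> real"
    and xh0 :: "nat \<Rightarrow> nat \<Rightarrow> real"
    and f :: "nat \<Rightarrow> real"
    and b :: "nat \<Rightarrow> nat \<Rightarrow> real"
    and \<W> \<beta> \<sigma> \<kappa> xstar :: real
    and p :: "complex vec"
    and q \<psi> \<tau> \<phi> Lt H :: "complex mat"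
  assumes prob: "prob_space M"
    and n_pos: "0 < n"
    and graph: "E \<subseteq> {..n} \<times> {..n}"
    and leader: "\<And>j. j < n \<Longrightarrow> (j, n) \<notin> E"
    and spanning: "\<exists>T. directed_spanning_tree {..n} E n T"
    and noise_normal: "0 < \<sigma>"
      "\<And>i j k. i < n \<Longrightarrow> j \<in> nbrs E i \<Longrightarrow> 0 < k \<Longrightarrow>
         distributed M lborel (\<xi> i j k) (normal_density 0 \<sigma>)"
    and noise_indep: "\<And>i j k. i < n \<Longrightarrow> j \<in> nbrs E i \<Longrightarrow> 0 < k \<Longrightarrow>
         prob_space.indep_set M (sets (vimage_algebra (space M) (\<xi> i j k) borel))
           (past_events M n E x xh k)"
    and init_x: "\<And>i \<omega>. i \<le> n \<Longrightarrow> \<omega> \<in> space M \<Longrightarrow> x i 0 \<omega> = x0 i"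
      "\<And>i. i < n \<Longrightarrow> \<bar>x0 i\<bar> \<le> \<W>"
    and init_xh: "\<And>i j \<omega>. i < n \<Longrightarrow> j \<in> nbrs E i \<Longrightarrow> \<omega> \<in> space M \<Longrightarrow> xh i j 0 \<omega> = xh0 i j"
      "\<And>i j. i < n \<Longrightarrow> j \<in> nbrs E i \<Longrightarrow> \<bar>xh0 i j\<bar> \<le> \<W>"
    and leader_update: "\<And>k \<omega>. \<omega> \<in> space M \<Longrightarrow> x n (k + 1) \<omega> = x n k \<omega> + f k"
    and follower_update: "\<And>i k \<omega>. i < n \<Longrightarrow> \<omega> \<in> space M \<Longrightarrow>
         x i (k + 1) \<omega> =
           x i k \<omega> - 1 / real (k + 1) * (\<Sum>j\<le>n. adj E i j * (x i k \<omega> - xh i j k \<omega>))"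
    and estimate_update: "\<And>i j k \<omega>. i < n \<Longrightarrow> j \<in> nbrs E i \<Longrightarrow> 0 < k \<Longrightarrow> \<omega> \<in> space M \<Longrightarrow>
         xh i j k \<omega> = closest_point {- \<W>..\<W>}
           (xh i j (k - 1) \<omega> + \<beta> / real k *
              (normal_cdf \<sigma> (b i j - xh i j (k - 1) \<omega>) -
               binary_obs (b i j) (x j k \<omega> + \<xi> i j k \<omega>)))"
    and leader_conv: "\<And>\<omega>. \<omega> \<in> space M \<Longrightarrow> (\<lambda>k. x n k \<omega>) \<longlonglongrightarrow> xstar"
    and xstar_bound: "\<bar>xstar\<bar> \<le> \<W>"
    and left_eigenvector: "eigenvector (transpose_mat (laplacian n E)) p 0"
      "(\<Sum>i\<le>n. vec_index p i) = 1"
    and decomposition: "laplacian_decomposition n (laplacian n E) q \<psi> \<tau> \<phi> Lt"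
    and lyapunov: "0 < \<kappa>" "hermitian_pos_def n H"
      "H * Lt + mat_adjoint Lt * H = complex_of_real \<kappa> \<cdot>\<^sub>m 1\<^sub>m n"
    and beta: "\<beta> > crs_l1 n E H \<phi> p / normal_density 0 \<sigma> (max_threshold n E b + \<W>)"
  shows "(\<forall>i\<le>n. \<forall>j\<in>nbrs E i. i \<noteq> j \<longrightarrow>
            (\<lambda>k. prob_space.expectation M (\<lambda>\<omega>. (xh i j k \<omega> - x j k \<omega>)^2)) \<longlonglongrightarrow> 0) \<and>
         (\<forall>i\<le>n.
            (\<lambda>k. prob_space.expectation M (\<lambda>\<omega>. (x i k \<omega> - x n k \<omega>)^2)) \<longlonglongrightarrow> 0)"
proof -
  interpret prob_space M by (rule prob)
  obtain T where tree: "directed_spanning_tree {..n} E n T" using spanning by blast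
  have fin: "finite (nbrs E i)" for i
    by (rule finite_subset[of _ "{..n}"]) (use graph in \<open>auto simp: nbrs_def\<close>)
  have nb: "j \<le> n" if "j \<in> nbrs E i" for i j
    using that graph by (auto simp: nbrs_def)
  \<comment> \<open>One existing link has two uses: it makes the list of follower pairs nonempty,
    and its noise gives access to the independence assumption when the past is shown to consist of
    events.\<close>
  obtain j0 where j0: "j0 \<in> nbrs E 0"
    using spanning_tree_nbrs_nonempty[OF tree, of 0] n_pos by auto
  have W: "0 \<le> \<W>" using xstar_bound by simp

  have "(0, j0) \<in> set (follower_pairs n E)"
    using n_pos j0 nb[OF j0] by (auto simp: follower_pairs_def simp del: upt_Suc intro!: bexI[of _ 0])
  then have "0 \<le> crs_l1 n E H \<phi> p"
    using decomposition by (intro crs_l1_nonneg[OF lyapunov(2) n_pos]) (auto simp: laplacian_decomposition_def)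
  then have "0 \<le> crs_l1 n E H \<phi> p / normal_density 0 \<sigma> (max_threshold n E b + \<W>)"
    by (intro divide_nonneg_nonneg) auto
  with beta have \<beta>: "0 < \<beta>" by linarith

  define N where "N k = sigma (space M) (past_events M n E x xh k)" for k
  have space_N: "space (N k) = space M" for k by (simp add: N_def space_measure_of_conv)
  have sets_N: "sets (N k) = past_events M n E x xh k" for k by (simp add: N_def sets_past_events)
  \<comment> \<open>Independence of two families includes that their members are events; this is
    where measurability of states and estimates comes from. Noise exists at positive times only,
    hence \<open>Suc k\<close>.\<close>
  have "sets (N (Suc k)) \<subseteq> sets M" for k
    using indep_setD_ev2[OF noise_indep[OF n_pos j0, of "Suc k"]] by (simp add: sets_N)
  then have NM: "h \<in> borel_measurable M" if "h \<in> borel_measurable (N (Suc k))" for h :: "'w \<Rightarrow> real" and k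
    using measurable_mono[OF subset_refl refl _ space_N] that by blast
  have xN: "x i s \<in> borel_measurable (N k)" if "i \<le> n" "s \<le> k" for i s k
    unfolding N_def using that by (rule past_measurable_state)
  have xhN: "xh i j s \<in> borel_measurable (N k)" if "i < n" "j \<in> nbrs E i" "s < k" for i j s k
    unfolding N_def using that by (rule past_measurable_estimate)
  have xM: "x i s \<in> borel_measurable M" if "i \<le> n" for i s
    by (rule NM[of _ s]) (rule xN[OF that], simp)
  have xhM: "xh i j s \<in> borel_measurable M" if "i < n" "j \<in> nbrs E i" for i j s
    by (rule NM[of _ s]) (rule xhN[OF that], simp)

  have xh_bound: "\<bar>xh i j k \<omega>\<bar> \<le> \<W>" if "i < n" "j \<in> nbrs E i" "\<omega> \<in> space M" for i j k \<omega>
  proof (cases k)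
    case 0
    then show ?thesis using init_xh that by simp
  next
    case (Suc l)
    then show ?thesis
      using estimate_update[OF that(1,2) _ that(3), of k] W by (simp add: closest_point_interval)
  qed
  have x_rec: "x i (Suc k) \<omega> = x i k \<omega> - 1 / real (k + 1) * (\<Sum>j\<in>nbrs E i. x i k \<omega> - xh i j k \<omega>)"
    if "i < n" "\<omega> \<in> space M" for i k \<omega>
  proof -
    have "(\<Sum>j\<le>n. adj E i j * (x i k \<omega> - xh i j k \<omega>)) = (\<Sum>j\<in>nbrs E i. x i k \<omega> - xh i j k \<omega>)"
      by (rule sum.mono_neutral_cong_right) (use nb in \<open>auto simp: adj_def\<close>)
    then show ?thesis using follower_update[OF that, of k] by simp
  qed
  define R0 where "R0 = (1 + 2 * real (n + 1)) ^ (n + 1) * \<W>"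
  have follower_bound: "\<bar>x i k \<omega>\<bar> \<le> R0" if "i < n" "\<omega> \<in> space M" for i k \<omega>
    unfolding R0_def
  proof (rule averaging_bounded[OF _ W x_rec[OF that]])
    show "card (nbrs E i) \<le> n + 1"
      using card_mono[of "{..n}" "nbrs E i"] nb by auto
    show "\<bar>x i 0 \<omega>\<bar> \<le> \<W>" using init_x that by simp
  qed (rule xh_bound[OF that(1) _ that(2)])
  \<comment> \<open>The leader is deterministic, so a bound for its convergent trajectory at one
    sample point holds at all of them.\<close>
  have leader_eq: "x n k \<omega> = x0 n + (\<Sum>l<k. f l)" if "\<omega> \<in> space M" for k \<omega>
    by (induction k) (use init_x(1)[OF _ that] leader_update[OF that] in auto)
  obtain \<omega>0 where "\<omega>0 \<in> space M" using not_empty by blast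
  from leader_conv[OF this] have "Bseq (\<lambda>k. x n k \<omega>0)"
    by (intro convergent_imp_Bseq) (auto simp: convergent_def)
  then obtain R1 where "\<And>k. \<bar>x n k \<omega>0\<bar> \<le> R1"
    by (auto simp: Bseq_def)
  then have leader_bound: "\<bar>x n k \<omega>\<bar> \<le> R1" if "\<omega> \<in> space M" for k \<omega>
    using that \<open>\<omega>0 \<in> space M\<close> by (simp add: leader_eq)
  define R where "R = max \<W> (max R0 R1)"
  have x_bound: "\<bar>x i k \<omega>\<bar> \<le> R" if "i \<le> n" "\<omega> \<in> space M" for i k \<omega>
    using follower_bound[of i \<omega> k] leader_bound[of \<omega> k] that by (cases "i = n") (auto simp: R_def)
  have xh_bound_R: "\<bar>xh i j k \<omega>\<bar> \<le> R" if "i < n" "j \<in> nbrs E i" "\<omega> \<in> space M" for i j k \<omega>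
    using xh_bound[OF that] by (simp add: R_def le_max_iff_disj)

  \<comment> \<open>Centring uses the true state \<open>x j l\<close>, not the estimate: only then
    is the mean zero given the past. For \<open>\<W> = 0\<close> observations cannot be recovered
    from estimates, and 0 keeps the increments measurable in the past.\<close>
  define m where "m i j l \<omega> = (if l = 0 \<or> \<W> = 0 then 0 else
      normal_cdf \<sigma> (b i j - x j l \<omega>) - binary_obs (b i j) (x j l \<omega> + \<xi> i j l \<omega>))" for i j l \<omega>
  have m_bound: "\<bar>m i j l \<omega>\<bar> \<le> 1" for i j l \<omega>
    using normal_cdf_range[OF noise_normal(1), of "b i j - x j l \<omega>"] by (auto simp: m_def binary_obs_def)
  \<comment> \<open>The strict inequality l < k matters: reading off the observation at time l takes
    the estimate at time l, which already depends on that noise and belongs only to later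
    pasts.\<close>
  have mN: "m i j l \<in> borel_measurable (N k)" if ij: "i < n" "j \<in> nbrs E i" and "l < k" for i j l k
  proof (cases "l = 0 \<or> \<W> = 0")
    case True
    then have "m i j l = (\<lambda>_. 0)" by (auto simp: m_def)
    then show ?thesis by simp
  next
    case False
    define h where "h \<omega> = normal_cdf \<sigma> (b i j - x j l \<omega>)
        - (if xh i j (l - 1) \<omega> < xh i j l \<omega> \<or> xh i j l \<omega> = xh i j (l - 1) \<omega> \<and> xh i j (l - 1) \<omega> = \<W> then 0 else 1)" for \<omega>
    have eq: "m i j l \<omega> = h \<omega>" if "\<omega> \<in> space (N k)" for \<omega>
    proof -
      note that = that[unfolded space_N]
      have "binary_obs (b i j) (x j l \<omega> + \<xi> i j l \<omega>)
          = (if xh i j (l - 1) \<omega> < xh i j l \<omega> \<or> xh i j l \<omega> = xh i j (l - 1) \<omega> \<and> xh i j (l - 1) \<omega> = \<W> then 0 else 1)"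
      proof (rule observation_from_estimates)
        show "xh i j l \<omega> = closest_point {- \<W>..\<W>} (xh i j (l - 1) \<omega> + \<beta> / real l *
            (normal_cdf \<sigma> (b i j - xh i j (l - 1) \<omega>) - binary_obs (b i j) (x j l \<omega> + \<xi> i j l \<omega>)))"
          using estimate_update[OF ij _ that] False by simp
        show "0 < \<W>" "0 < \<beta> / real l" using False W \<beta> by auto
        show "\<bar>xh i j (l - 1) \<omega>\<bar> \<le> \<W>" by (rule xh_bound[OF ij that])
      qed (auto simp: binary_obs_def normal_cdf_range[OF noise_normal(1)])
      then show ?thesis using False by (simp add: m_def h_def)
    qed
    note [measurable] = borel_measurable_normal_cdf[OF noise_normal(1)]
    have [measurable]: "x j l \<in> borel_measurable (N k)" "xh i j (l - 1) \<in> borel_measurable (N k)"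
      "xh i j l \<in> borel_measurable (N k)"
      using \<open>l < k\<close> by (auto intro!: xN xhN nb[OF ij(2)] ij)
    have "h \<in> borel_measurable (N k)" unfolding h_def by measurable
    then show ?thesis by (rule measurable_cong[THEN iffD2, rotated]) (rule eq)
  qed
  have noise: "AE \<omega> in M. (\<lambda>k. (\<Sum>l=1..k. m i j l \<omega>) / real k) \<longlonglongrightarrow> 0"
    if ij: "i < n" "j \<in> nbrs E i" for i j
  proof (rule orthogonal_bounded_averages)
    show "m i j l \<in> borel_measurable M" for l
      by (rule NM[of _ l]) (rule mN[OF ij], simp)
    show "expectation (\<lambda>\<omega>. (\<Sum>l=1..k. m i j l \<omega>) * m i j (Suc k) \<omega>) = 0" for k
    proof (cases "\<W> = 0")
      case True
      then show ?thesis by (simp add: m_def)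
    next
      case False
      have "expectation (\<lambda>\<omega>. (\<Sum>l=1..k. m i j l \<omega>) * (normal_cdf \<sigma> (b i j - x j (Suc k) \<omega>)
          - binary_obs (b i j) (x j (Suc k) \<omega> + \<xi> i j (Suc k) \<omega>))) = 0"
      proof (rule noise_centered[OF noise_normal(1)])
        show "distributed M lborel (\<xi> i j (Suc k)) (normal_density 0 \<sigma>)"
          by (rule noise_normal(2)[OF ij]) simp
        show "indep_set (sets (vimage_algebra (space M) (\<xi> i j (Suc k)) borel)) (sets (N (Suc k)))"
          unfolding sets_N by (rule noise_indep[OF ij]) simp
        show "(\<lambda>\<omega>. \<Sum>l=1..k. m i j l \<omega>) \<in> borel_measurable (N (Suc k))"
          by (intro borel_measurable_sum mN[OF ij]) auto
        show "x j (Suc k) \<in> borel_measurable (N (Suc k))"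
          by (rule xN[OF nb[OF ij(2)]]) simp
        show "\<bar>\<Sum>l=1..k. m i j l \<omega>\<bar> \<le> real k" for \<omega>
          using sum_mono[of "{1..k}" "\<lambda>l. \<bar>m i j l \<omega>\<bar>" "\<lambda>_. 1"] m_bound
          by (intro order_trans[OF sum_abs]) simp
      qed (rule space_N)
      then show ?thesis using False by (simp add: m_def)
    qed
  qed (rule m_bound)
  then have "AE \<omega> in M. \<forall>i\<in>{..<n}. \<forall>j\<in>nbrs E i. (\<lambda>k. (\<Sum>l=1..k. m i j l \<omega>) / real k) \<longlonglongrightarrow> 0"
    using fin by (intro AE_finite_allI) auto
  moreover have paths: "(\<forall>i\<le>n. (\<lambda>k. x i k \<omega>) \<longlonglongrightarrow> xstar) \<and> (\<forall>i<n. \<forall>j\<in>nbrs E i. (\<lambda>k. xh i j k \<omega>) \<longlonglongrightarrow> xstar)"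
    if \<omega>: "\<omega> \<in> space M" and avg: "\<forall>i\<in>{..<n}. \<forall>j\<in>nbrs E i. (\<lambda>k. (\<Sum>l=1..k. m i j l \<omega>) / real k) \<longlonglongrightarrow> 0"
    for \<omega>
  proof -
    \<comment> \<open>K dominates every argument at which the distribution function is evaluated, so
      one lower slope bound serves all links and times.\<close>
    define K where "K = (\<Sum>i<n. \<Sum>j\<le>n. \<bar>b i j\<bar>) + R"
    have K: "\<bar>b i j - z\<bar> \<le> K" if "i < n" "j \<le> n" "\<bar>z\<bar> \<le> R" for i j z
    proof -
      have "\<bar>b i j\<bar> \<le> (\<Sum>j\<le>n. \<bar>b i j\<bar>)"
        using that by (intro member_le_sum) auto
      also have "\<dots> \<le> (\<Sum>i<n. \<Sum>j\<le>n. \<bar>b i j\<bar>)"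
        using that by (intro member_le_sum[where f = "\<lambda>i. \<Sum>j\<le>n. \<bar>b i j\<bar>"]) (auto intro: sum_nonneg)
      finally show ?thesis using that unfolding K_def by linarith
    qed
    let ?lo = "normal_density 0 \<sigma> K" and ?hi = "normal_density 0 \<sigma> 0"
    \<comment> \<open>The side conditions stand inside the existential so that choice yields a total
      function g. The old estimate is compared with the new state, as the observation at time k + 1
      is taken of the latter.\<close>
    have "\<exists>g. i < n \<longrightarrow> j \<in> nbrs E i \<longrightarrow> ?lo \<le> g \<and> g \<le> ?hi \<and>
        normal_cdf \<sigma> (b i j - xh i j k \<omega>) - normal_cdf \<sigma> (b i j - x j (Suc k) \<omega>)
          = g * ((b i j - xh i j k \<omega>) - (b i j - x j (Suc k) \<omega>))" for i j k
      using normal_cdf_secant[OF noise_normal(1) K K, of i j "xh i j k \<omega>" i j "x j (Suc k) \<omega>"]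
        xh_bound_R[of i j \<omega> k] x_bound[of j \<omega> "Suc k"] nb[of j i] \<omega> by blast
    then obtain g where g: "\<And>i j k. i < n \<Longrightarrow> j \<in> nbrs E i \<Longrightarrow> ?lo \<le> g i j k \<and> g i j k \<le> ?hi \<and>
        normal_cdf \<sigma> (b i j - xh i j k \<omega>) - normal_cdf \<sigma> (b i j - x j (Suc k) \<omega>)
          = g i j k * ((b i j - xh i j k \<omega>) - (b i j - x j (Suc k) \<omega>))"
      by metis
    have xh_rec: "xh i j (Suc k) \<omega> = closest_point {- \<W>..\<W>}
        (xh i j k \<omega> - \<beta> * g i j k / real (k + 1) * (xh i j k \<omega> - x j (Suc k) \<omega>)
          + \<beta> / real (k + 1) * m i j (Suc k) \<omega>)" if ij: "i < n" "j \<in> nbrs E i" for i j k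
    \<comment> \<open>For \<open>\<W> = 0\<close> both sides are projected to the single point 0, so
      the recursion holds although \<open>m\<close> omits the noise.\<close>
    proof (cases "\<W> = 0")
      case True
      have "closest_point {0} z = 0" for z :: real
        using closest_point_interval[of 0 z] by simp
      then show ?thesis
        using True estimate_update[OF ij _ \<omega>, of "Suc k"] by simp
    next
      case False
      have upd: "xh i j (Suc k) \<omega> = closest_point {- \<W>..\<W>} (xh i j k \<omega> + \<beta> / real (k + 1) *
          (normal_cdf \<sigma> (b i j - xh i j k \<omega>) - binary_obs (b i j) (x j (Suc k) \<omega> + \<xi> i j (Suc k) \<omega>)))"
        using estimate_update[OF ij _ \<omega>, of "Suc k"] by simp
      have eq: "normal_cdf \<sigma> (b i j - xh i j k \<omega>) - binary_obs (b i j) (x j (Suc k) \<omega> + \<xi> i j (Suc k) \<omega>)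
          = m i j (Suc k) \<omega> - g i j k * (xh i j k \<omega> - x j (Suc k) \<omega>)"
        using g[OF ij, of k] False by (simp add: m_def algebra_simps)
      show ?thesis
        unfolding upd eq by (rule arg_cong) (simp add: divide_inverse algebra_simps)
    qed
    have pos: "0 < \<beta> * ?lo"
      using \<beta> normal_density_pos[OF noise_normal(1)] by simp
    have lo: "\<beta> * ?lo \<le> \<beta> * g i j k" and hi: "\<beta> * g i j k \<le> \<beta> * ?hi"
      if "i < n" "j \<in> nbrs E i" for i j k
      using g[OF that, of k] \<beta> by simp_all
    have avg': "(\<lambda>k. (\<Sum>l=1..k. m i j l \<omega>) / real k) \<longlonglongrightarrow> 0" if "i < n" "j \<in> nbrs E i" for i j
      using avg that by simp
    note path = crs_path_converges[where x = "\<lambda>i k. x i k \<omega>" and xh = "\<lambda>i j k. xh i j k \<omega>"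
        and m = "\<lambda>i j k. m i j k \<omega>" and g = "\<lambda>i j k. \<beta> * g i j k",
        OF graph tree x_bound[OF _ \<omega>] xstar_bound leader_conv[OF \<omega>] x_rec[OF _ \<omega>] pos lo hi xh_rec avg']
    show ?thesis
      by (intro conjI allI impI ballI path)
  qed
  ultimately have conv: "AE \<omega> in M. (\<forall>i\<le>n. (\<lambda>k. x i k \<omega>) \<longlonglongrightarrow> xstar) \<and>
      (\<forall>i<n. \<forall>j\<in>nbrs E i. (\<lambda>k. xh i j k \<omega>) \<longlonglongrightarrow> xstar)"
    by (rule AE_mp[OF _ AE_I2[OF impI]])
  show ?thesis
  proof (intro conjI allI ballI impI)
    fix i j assume ij: "i \<le> n" "j \<in> nbrs E i" "i \<noteq> j"
    \<comment> \<open>The leader hears no follower, so its only possible neighbour is itself, and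
      that pair is excluded.\<close>
    have "i \<noteq> n"
      using ij leader[of j] nb[OF ij(2)] by (auto simp: nbrs_def)
    then have i: "i < n" using ij by simp
    note j = nb[OF ij(2)]
    have "AE \<omega> in M. (\<lambda>k. xh i j k \<omega>) \<longlonglongrightarrow> xstar \<and> (\<lambda>k. x j k \<omega>) \<longlonglongrightarrow> xstar"
      using conv by eventually_elim (use i j ij(2) in auto)
    then show "(\<lambda>k. expectation (\<lambda>\<omega>. (xh i j k \<omega> - x j k \<omega>)\<^sup>2)) \<longlonglongrightarrow> 0"
      by (intro mean_square_convergence[where u = "xh i j" and v = "x j" and R = R]
          xhM[OF i ij(2)] xM[OF j] xh_bound_R[OF i ij(2)] x_bound[OF j])
  next
    fix i assume i: "i \<le> n"
    have "AE \<omega> in M. (\<lambda>k. x i k \<omega>) \<longlonglongrightarrow> xstar \<and> (\<lambda>k. x n k \<omega>) \<longlonglongrightarrow> xstar"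
      using conv by eventually_elim (use i in auto)
    then show "(\<lambda>k. expectation (\<lambda>\<omega>. (x i k \<omega> - x n k \<omega>)\<^sup>2)) \<longlonglongrightarrow> 0"
      by (intro mean_square_convergence[where u = "x i" and v = "x n" and R = R]
          xM[OF i] xM[OF order_refl] x_bound[OF i] x_bound[OF order_refl])
  qed
qed

end
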